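(* Let $k\ge 1$ be an integer and $\theta = 2\pi/(4k+2)$. Let $P$ be a finite set of points in general position and $S$ a set of constraints on $P$. Let $u,w\in P$ be two vertices such that $u$ can see $w$, let $m$ be the midpoint of the side of the canonical triangle $T_{uw}$ opposite $u$, and let $\alpha$ be the unsigned angle between the segments $uw$ and $um$. Then there exists a path connecting $u$ and $w$ in the constrained $\theta_{(4k+2)}$-graph of $P$ with respect to $S$ of length at most \[\left( \frac{1 + \sin \left(\frac{\theta}{2}\right)}{\cos \left(\frac{\theta}{2}\right)} \cdot \cos \alpha + \sin \alpha \right) \cdot |u w|.\]
   Context: $P$ is a finite set of points in the plane and $S$ is a set of line segments (called constraints), each joining two points of $P$, such that no two constraints intersect properly. Two points $u,v\in P$ can see each other if and only if the segment $uv$ does not properly intersect any constraint or $uv$ is itself a constraint. Fix an integer $k\ge 1$, $x\in\{2,3,4,5\}$ and $\theta=2\pi/(4k+x)$. Around each point $u$, the $4k+x$ rays from $u$ with angle $\theta$ between consecutive rays define cones (regions between consecutive rays with apex $u$); they are oriented so that the bisector of one cone, $C_0^u$, is the vertical half-line above $u$, and the cones are numbered $C_0^u, C_1^u, \dots$ clockwise; all points use the same orientation. For every constraint $uv$ with $v\in C_i^u$, the line through that constraint splits $C_i^u$; the resulting pieces are the subcones of $C_i^u$ (if a constraint $uv$ splits a cone of $u$ into two subcones, $v$ is considered to lie in both; a cone not split is a single subcone). The constrained $\theta_{(4k+x)}$-graph has vertex set $P$ and, for each vertex $u$ and each subcone of each cone $C_i^u$, an edge between $u$ and the vertex $v$ of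 that subcone that can see $u$ and whose orthogonal projection onto the bisector of the full cone $C_i^u$ (not of the subcone) is closest to $u$ among all vertices of that subcone that can see $u$. Edges are weighted by Euclidean length, and the length of a path is the sum of its edge lengths. General position: no two points lie on a line parallel to one of the rays defining the cones, no two points lie on a line perpendicular to the bisector of a cone, and no three points are collinear. For a vertex $w$ in cone $C_i^u$, the canonical triangle $T_{uw}$ is the triangle bounded by the two boundary rays of $C_i^u$ and the line through $w$ perpendicular to the bisector of $C_i^u$. *)

theory Defs
  imports "HOL-Analysis.Analysis"
begin

text \<open>Points of the plane are complex numbers. There are n cones around each point,
  theta = 2 pi / n. Directions are measured clockwise from the vertical upward direction.\<close>

definition cone_angle :: "nat \<Rightarrow> real" where
  "cone_angle n = 2 * pi / real n"

definition dir :: "real \<Rightarrow> complex" where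
  "dir phi = cis (pi / 2 - phi)"

text \<open>bisector direction of cone C_i (cones numbered clockwise, C_0 bisected by upward vertical)\<close>
definition bis :: "nat \<Rightarrow> nat \<Rightarrow> complex" where
  "bis n i = dir (real i * cone_angle n)"

text \<open>signed angular offset of w - u from the bisector of C_i^u (counterclockwise positive)\<close>
definition offs :: "nat \<Rightarrow> nat \<Rightarrow> complex \<Rightarrow> complex \<Rightarrow> real" where
  "offs n i u w = Arg ((w - u) / bis n i)"

text \<open>w lies in cone C_i^u (open cone; boundary rays excluded, which never matters under
  general position)\<close>
definition in_cone :: "nat \<Rightarrow> nat \<Rightarrow> complex \<Rightarrow> complex \<Rightarrow> bool" where
  "in_cone n i u w \<longleftrightarrow> w \<noteq> u \<and> \<bar>offs n i u w\<bar> < cone_angle n / 2"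

definition proj :: "nat \<Rightarrow> nat \<Rightarrow> complex \<Rightarrow> complex \<Rightarrow> real" where
  "proj n i u w = Re ((w - u) * cnj (bis n i))"

definition is_constraint :: "(complex \<times> complex) set \<Rightarrow> complex \<Rightarrow> complex \<Rightarrow> bool" where
  "is_constraint S a b \<longleftrightarrow> (a, b) \<in> S \<or> (b, a) \<in> S"

definition properly_intersect :: "complex \<Rightarrow> complex \<Rightarrow> complex \<Rightarrow> complex \<Rightarrow> bool" where
  "properly_intersect a b c d \<longleftrightarrow> open_segment a b \<inter> open_segment c d \<noteq> {}"

definition sees :: "(complex \<times> complex) set \<Rightarrow> complex \<Rightarrow> complex \<Rightarrow> bool" where
  "sees S u v \<longleftrightarrow> is_constraint S u v \<or> (\<forall>(a, b) \<in> S. \<not> properly_intersect u v a b)"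

text \<open>Set of angular offsets delimiting the subcones of C_i^u: the two boundary rays and
  the constraints uv with v in C_i^u.\<close>
definition sub_bounds :: "complex set \<Rightarrow> (complex \<times> complex) set \<Rightarrow> nat \<Rightarrow> nat \<Rightarrow> complex \<Rightarrow> real set" where
  "sub_bounds P S n i u =
     {- cone_angle n / 2, cone_angle n / 2} \<union>
     {offs n i u v | v. v \<in> P \<and> is_constraint S u v \<and> in_cone n i u v}"

definition is_subcone :: "complex set \<Rightarrow> (complex \<times> complex) set \<Rightarrow> nat \<Rightarrow> nat \<Rightarrow> complex \<Rightarrow> real \<Rightarrow> real \<Rightarrow> bool" where
  "is_subcone P S n i u lo hi \<longleftrightarrow>
     lo \<in> sub_bounds P S n i u \<and> hi \<in> sub_bounds P S n i u \<and> lo < hi \<and>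
     \<not> (\<exists>c \<in> sub_bounds P S n i u. lo < c \<and> c < hi)"

text \<open>the points of P in the subcone (lo, hi) of C_i^u (a constraint endpoint v lies in both
  adjacent subcones)\<close>
definition subcone_pts :: "complex set \<Rightarrow> nat \<Rightarrow> nat \<Rightarrow> complex \<Rightarrow> real \<Rightarrow> real \<Rightarrow> complex set" where
  "subcone_pts P n i u lo hi =
     {w \<in> P. in_cone n i u w \<and> lo \<le> offs n i u w \<and> offs n i u w \<le> hi}"

definition dir_edge :: "complex set \<Rightarrow> (complex \<times> complex) set \<Rightarrow> nat \<Rightarrow> complex \<Rightarrow> complex \<Rightarrow> bool" where
  "dir_edge P S n u v \<longleftrightarrow>
     (\<exists>i < n. \<exists>lo hi. is_subcone P S n i u lo hi \<and> v \<in> subcone_pts P n i u lo hi \<and>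
        sees S u v \<and>
        (\<forall>w \<in> subcone_pts P n i u lo hi. sees S u w \<longrightarrow> proj n i u v \<le> proj n i u w))"

definition theta_edge :: "complex set \<Rightarrow> (complex \<times> complex) set \<Rightarrow> nat \<Rightarrow> complex \<Rightarrow> complex \<Rightarrow> bool" where
  "theta_edge P S n u v \<longleftrightarrow> u \<in> P \<and> v \<in> P \<and> (dir_edge P S n u v \<or> dir_edge P S n v u)"

definition is_path :: "complex set \<Rightarrow> (complex \<times> complex) set \<Rightarrow> nat \<Rightarrow> complex list \<Rightarrow> complex \<Rightarrow> complex \<Rightarrow> bool" where
  "is_path P S n ps u w \<longleftrightarrow> ps \<noteq> [] \<and> hd ps = u \<and> last ps = w \<and>
     (\<forall>j. j + 1 < length ps \<longrightarrow> theta_edge P S n (ps ! j) (ps ! (j + 1)))"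

definition path_length :: "complex list \<Rightarrow> real" where
  "path_length ps = (\<Sum>j < length ps - 1. cmod (ps ! (j + 1) - ps ! j))"

definition general_position :: "nat \<Rightarrow> complex set \<Rightarrow> bool" where
  "general_position n P \<longleftrightarrow>
     (\<forall>p \<in> P. \<forall>q \<in> P. p \<noteq> q \<longrightarrow>
        (\<forall>j < n. Im ((q - p) * cnj (dir ((real j + 1/2) * cone_angle n))) \<noteq> 0) \<and>
        (\<forall>i < n. Re ((q - p) * cnj (bis n i)) \<noteq> 0)) \<and>
     (\<forall>p \<in> P. \<forall>q \<in> P. \<forall>r \<in> P. p \<noteq> q \<and> q \<noteq> r \<and> p \<noteq> r \<longrightarrow> \<not> collinear {p, q, r})"

definition constraints_on :: "complex set \<Rightarrow> (complex \<times> complex) set \<Rightarrow> bool" where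
  "constraints_on P S \<longleftrightarrow>
     (\<forall>(a, b) \<in> S. a \<in> P \<and> b \<in> P \<and> a \<noteq> b) \<and>
     (\<forall>(a, b) \<in> S. \<forall>(c, d) \<in> S. closed_segment a b \<noteq> closed_segment c d \<longrightarrow>
        \<not> properly_intersect a b c d)"

text \<open>corners of the canonical triangle T_uw (w in C_i^u) on the side opposite u:
  s = 1 / s = -1 for the two boundary rays\<close>
definition tri_corner :: "nat \<Rightarrow> nat \<Rightarrow> complex \<Rightarrow> complex \<Rightarrow> real \<Rightarrow> complex" where
  "tri_corner n i u w s =
     u + complex_of_real (proj n i u w / cos (cone_angle n / 2)) * bis n i * cis (s * cone_angle n / 2)"

definition vec_angle :: "complex \<Rightarrow> complex \<Rightarrow> real" where
  "vec_angle x y = arccos (inner x y / (norm x * norm y))"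

end

theory Submission
  imports Defs
begin

text \<open>
  Strong induction on the height of \<open>T\<^sub>u\<^sub>w\<close>, with the stronger hypothesis that the path has length
  at most \<open>max (|ua| + |aw|) (|ub| + |bw|)\<close>, where \<open>a\<close> and \<open>b\<close> are the corners of \<open>T\<^sub>u\<^sub>w\<close>, and at most
  \<open>|ub| + |bw|\<close> if the triangle \<open>uaw\<close> contains no vertex (and symmetrically).

  If \<open>uw\<close> is not an edge, let \<open>v\<close> be the neighbour of \<open>u\<close> in the subcone of \<open>w\<close>, say to the left of
  \<open>uw\<close>. The lower convex hull of the vertices between the rays \<open>uv\<close> and \<open>uw\<close> is a chain of mutually
  visible vertices from \<open>v\<close> to \<open>w\<close>, and the polygon between \<open>u\<close> and this chain is empty. All its
  edges ascend, so an edge lies in one of the cones \<open>C\<^sub>0, \<dots>, C\<^sub>k\<close>, and induction bounds the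
  distance of its endpoints by their \<open>|va| + |aw|\<close> in the frame of \<open>C\<^sub>0\<close>, which is additive along
  the chain. The two exceptions are edges of \<open>C\<^sub>0\<close> pointing left, which come last by convexity, and
  edges below the bisector of \<open>C\<^sub>k\<close>: there the triangle seen from the upper endpoint is part of the
  empty polygon and the sharper hypothesis applies, giving exactly the same value.
\<close>

subsection \<open>Bounded-length connections\<close>

definition conn :: "complex set \<Rightarrow> (complex \<times> complex) set \<Rightarrow> nat \<Rightarrow> complex \<Rightarrow> complex \<Rightarrow> real \<Rightarrow> bool" where
  "conn P S n u w L \<longleftrightarrow> (\<exists>ps. is_path P S n ps u w \<and> path_length ps \<le> L)"

lemma conn_mono: "conn P S n u w L \<Longrightarrow> L \<le> L' \<Longrightarrow> conn P S n u w L'"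
  unfolding conn_def by force

lemma theta_edge_sym: "theta_edge P S n u v \<longleftrightarrow> theta_edge P S n v u"
  unfolding theta_edge_def by auto

lemma conn_edge: "theta_edge P S n u v \<Longrightarrow> conn P S n u v (cmod (v - u))"
  unfolding conn_def is_path_def path_length_def
  by (rule exI[of _ "[u, v]"]) auto

lemma is_path_Cons_Cons:
  "is_path P S n (a # b # ps) u w \<longleftrightarrow> a = u \<and> theta_edge P S n a b \<and> is_path P S n (b # ps) b w"
proof -
  have "(\<forall>j. j + 1 < length (a # b # ps) \<longrightarrow> theta_edge P S n ((a # b # ps) ! j) ((a # b # ps) ! (j + 1)))
     \<longleftrightarrow> theta_edge P S n a b \<and>
       (\<forall>j. j + 1 < length (b # ps) \<longrightarrow> theta_edge P S n ((b # ps) ! j) ((b # ps) ! (j + 1)))"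
    by (auto simp: nth_Cons split: nat.splits)
  then show ?thesis unfolding is_path_def by auto
qed

lemma path_length_Cons_Cons:
  "path_length (a # b # ps) = cmod (b - a) + path_length (b # ps)"
  unfolding path_length_def by (simp add: sum.lessThan_Suc_shift del: sum.lessThan_Suc)

lemma conn_Cons:
  assumes "theta_edge P S n u v" "conn P S n v w L"
  shows "conn P S n u w (cmod (v - u) + L)"
proof -
  obtain ps where ps: "is_path P S n ps v w" "path_length ps \<le> L"
    using assms(2) unfolding conn_def by auto
  then obtain qs where qs: "ps = v # qs" unfolding is_path_def by (cases ps) auto
  show ?thesis unfolding conn_def
    by (rule exI[of _ "u # v # qs"])
       (use ps qs assms(1) in \<open>auto simp: is_path_Cons_Cons path_length_Cons_Cons\<close>)
qed

lemma conn_refl: "conn P S n u u 0"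
  unfolding conn_def is_path_def path_length_def by (rule exI[of _ "[u]"]) auto

lemma conn_path_trans:
  "is_path P S n ps u v \<Longrightarrow> conn P S n v w L \<Longrightarrow> conn P S n u w (path_length ps + L)"
proof (induction ps arbitrary: u)
  case Nil
  then show ?case by (simp add: is_path_def)
next
  case (Cons a ps)
  show ?case
  proof (cases ps)
    case Nil
    then show ?thesis using Cons by (auto simp: is_path_def path_length_def)
  next
    case (Cons b qs)
    with Cons.prems have *: "a = u" "theta_edge P S n a b" "is_path P S n ps b v"
      by (auto simp: is_path_Cons_Cons)
    from conn_Cons[OF *(2) Cons.IH[OF *(3) Cons.prems(2)]] show ?thesis
      using *(1) Cons by (simp add: path_length_Cons_Cons add.assoc)
  qed
qed

lemma conn_trans:
  assumes "conn P S n u v L" "conn P S n v w L'"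
  shows "conn P S n u w (L + L')"
proof -
  obtain ps where ps: "is_path P S n ps u v" "path_length ps \<le> L"
    using assms(1) unfolding conn_def by auto
  from conn_mono[OF conn_path_trans[OF ps(1) assms(2)]] ps(2) show ?thesis by simp
qed

lemma conn_path_sym: "is_path P S n ps u v \<Longrightarrow> conn P S n v u (path_length ps)"
proof (induction ps arbitrary: u)
  case Nil
  then show ?case by (simp add: is_path_def)
next
  case (Cons a ps)
  show ?case
  proof (cases ps)
    case Nil
    then show ?thesis using Cons by (auto simp: is_path_def path_length_def conn_refl)
  next
    case (Cons b qs)
    with Cons.prems have *: "a = u" "theta_edge P S n b a" "is_path P S n ps b v"
      by (auto simp: is_path_Cons_Cons theta_edge_sym)
    from conn_trans[OF Cons.IH[OF *(3)] conn_edge[OF *(2)]] show ?thesis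
      using *(1) Cons by (simp add: path_length_Cons_Cons norm_minus_commute add.commute)
  qed
qed

lemma conn_sym: "conn P S n u v L \<Longrightarrow> conn P S n v u L"
  by (metis conn_def conn_mono conn_path_sym)

subsection \<open>The visible convex chain in a wedge\<close>

text \<open>The plane cross product; its sign tells on which side of the direction \<open>a\<close>
  the vector \<open>b\<close> lies.\<close>

definition cr :: "complex \<Rightarrow> complex \<Rightarrow> real" where
  "cr a b = Re a * Im b - Im a * Re b"

lemma cr_zero_imp_collinear:
  assumes "cr (q - p) (r - p) = 0"
  shows "collinear {p, q, r}"
proof -
  have "collinear {0, q - p, r - p}"
  proof (cases "q = p")
    case False
    define c where "c = Re ((r - p) / (q - p))"
    have im: "Im ((r - p) / (q - p)) = 0"
      using assms False by (simp add: Im_divide cr_def algebra_simps)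
    have "(r - p) / (q - p) = of_real c"
      using im by (simp add: c_def complex_eq_iff)
    then have "r - p = c *\<^sub>R (q - p)"
      using False by (simp add: field_simps scaleR_conv_of_real)
    then show ?thesis by (auto simp: collinear_lemma)
  qed auto
  then have "collinear {q, p, r}" by (subst collinear_3) auto
  then show ?thesis by (simp add: insert_commute)
qed


text \<open>A sight line that is crossed by a constraint is itself a constraint, and two constraints
  meet in interior points only if they are the same segment.\<close>

lemma visible_not_crossed:
  assumes "constraints_on P S" "sees S u v" "is_constraint S a b"
    and "x \<in> open_segment u v" "x \<in> open_segment a b"
  shows "{a, b} = {u, v}"
proof -
  obtain a' b' where ab: "(a', b') \<in> S" "{a', b'} = {a, b}"
    using assms(3) unfolding is_constraint_def by blast
  have ab': "x \<in> open_segment a' b'"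
    using ab(2) assms(5) by (auto simp: doubleton_eq_iff open_segment_commute)
  from assms(2) have "\<exists>(u', v') \<in> S. {u', v'} = {u, v}"
    unfolding sees_def properly_intersect_def is_constraint_def
    using ab(1) ab' assms(4) by blast
  then obtain u' v' where uv: "(u', v') \<in> S" "{u', v'} = {u, v}" by blast
  have uv': "x \<in> open_segment u' v'"
    using uv(2) assms(4) by (auto simp: doubleton_eq_iff open_segment_commute)
  have "closed_segment a' b' = closed_segment u' v'"
    using assms(1) ab(1) uv(1) ab' uv' unfolding constraints_on_def properly_intersect_def
    by blast
  then show ?thesis using ab(2) uv(2) by (simp add: closed_segment_eq)
qed

lemma open_segment_shrink:
  fixes x a e :: complex
  assumes "x \<in> open_segment a e" "0 < t" "t < 1"
  shows "(1 - t) *\<^sub>R x + t *\<^sub>R e \<in> open_segment a e"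
proof -
  obtain r where r: "0 < r" "r < 1" "x = (1 - r) *\<^sub>R a + r *\<^sub>R e" and ae: "a \<noteq> e"
    using assms(1) by (auto simp: in_segment)
  have "(1 - t) *\<^sub>R x + t *\<^sub>R e = (1 - (r + t - r * t)) *\<^sub>R a + (r + t - r * t) *\<^sub>R e"
    unfolding r(3) by (simp add: algebra_simps)
  moreover have "0 < r + t - r * t"
  proof -
    have "r * t < r" using r assms by simp
    then show ?thesis using assms by linarith
  qed
  moreover have "r + t - r * t < 1"
  proof -
    have "0 < (1 - r) * (1 - t)" using r assms by simp
    then show ?thesis by (simp add: algebra_simps)
  qed
  ultimately show ?thesis using ae unfolding in_segment by blast
qed

lemma seesI:
  assumes "\<And>a b x. is_constraint S a b \<Longrightarrow> x \<in> open_segment p q \<Longrightarrow> x \<in> open_segment a b \<Longrightarrow> {a, b} = {p, q}"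
  shows "sees S p q"
  unfolding sees_def properly_intersect_def is_constraint_def
proof (rule disjCI)
  assume "\<not> (\<forall>(a, b)\<in>S. \<not> open_segment p q \<inter> open_segment a b \<noteq> {})"
  then obtain a b x where "(a, b) \<in> S" "x \<in> open_segment p q" "x \<in> open_segment a b" by auto
  moreover from this have "{a, b} = {p, q}" using assms[of a b x] by (auto simp: is_constraint_def)
  ultimately show "(p, q) \<in> S \<or> (q, p) \<in> S" by (auto simp: doubleton_eq_iff)
qed

lemma sees_sym: "sees S a b \<Longrightarrow> sees S b a"
  unfolding sees_def is_constraint_def properly_intersect_def
  by (auto simp: open_segment_commute)

text \<open>The wedge between two sight lines from \<open>u\<close>. The hypothesis
  \<open>nocon\<close> is met when \<open>v\<close> and \<open>w\<close> share a subcone, as a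
  constraint at \<open>u\<close> strictly between them would separate them.\<close>

locale wedge =
  fixes P :: "complex set" and S :: "(complex \<times> complex) set" and u v w :: complex
  assumes fin: "finite P"
    and nc: "\<And>p q r. p \<in> P \<Longrightarrow> q \<in> P \<Longrightarrow> r \<in> P \<Longrightarrow> p \<noteq> q \<Longrightarrow> q \<noteq> r \<Longrightarrow> p \<noteq> r \<Longrightarrow> cr (q - p) (r - p) \<noteq> 0"
    and cons: "constraints_on P S"
    and uP: "u \<in> P" and vP: "v \<in> P" and wP: "w \<in> P"
    and uv: "u \<noteq> v" and uw: "u \<noteq> w" and vw: "v \<noteq> w"
    and suv: "sees S u v" and suw: "sees S u w"
    and nocon: "\<And>p a b. p \<in> P \<Longrightarrow> is_constraint S u p \<Longrightarrow>
      p - u = a *\<^sub>R (v - u) + b *\<^sub>R (w - u) \<Longrightarrow> 0 < a \<Longrightarrow> 0 < b \<Longrightarrow> False"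
begin

text \<open>\<open>A\<close> and \<open>B\<close> are the coordinates in the basis
  \<open>v - u\<close>, \<open>w - u\<close>, by Cramer's rule. The wedge is where both are
  nonnegative.\<close>

definition A :: "complex \<Rightarrow> real" where
  "A p = cr (p - u) (w - u) / cr (v - u) (w - u)"

definition B :: "complex \<Rightarrow> real" where
  "B p = cr (v - u) (p - u) / cr (v - u) (w - u)"

lemma D0: "cr (v - u) (w - u) \<noteq> 0"
  using nc[OF uP vP wP] uv uw vw by auto

lemma decomp: "p - u = A p *\<^sub>R (v - u) + B p *\<^sub>R (w - u)"
proof -
  have solve: "z = a / d * x + b / d * y" if "d * z = a * x + b * y" "d \<noteq> 0" for a b d x y z :: real
  proof -
    have "z = (a * x + b * y) / d" using that by (metis nonzero_mult_div_cancel_left)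
    then show ?thesis by (simp add: add_divide_distrib)
  qed
  have "Re (p - u) = A p * Re (v - u) + B p * Re (w - u)"
    unfolding A_def B_def by (rule solve[OF _ D0]) (simp add: cr_def algebra_simps)
  moreover have "Im (p - u) = A p * Im (v - u) + B p * Im (w - u)"
    unfolding A_def B_def by (rule solve[OF _ D0]) (simp add: cr_def algebra_simps)
  ultimately show ?thesis by (simp add: complex_eq_iff)
qed

lemma coords_unique:
  assumes "p - u = a *\<^sub>R (v - u) + b *\<^sub>R (w - u)"
  shows "A p = a" "B p = b"
proof -
  have "cr (p - u) (w - u) = a * cr (v - u) (w - u)"
    unfolding assms by (simp add: cr_def algebra_simps)
  then show "A p = a" using D0 by (simp add: A_def)
  have "cr (v - u) (p - u) = b * cr (v - u) (w - u)"
    unfolding assms by (simp add: cr_def algebra_simps)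
  then show "B p = b" using D0 by (simp add: B_def)
qed

lemma coords_simps [simp]:
  "A u = 0" "B u = 0" "A v = 1" "B v = 0" "A w = 0" "B w = 1"
  using D0 by (simp_all add: A_def B_def) (simp_all add: cr_def)

lemma A_affine: "A ((1 - t) *\<^sub>R x + t *\<^sub>R y) = (1 - t) * A x + t * A y"
proof -
  have "cr (((1 - t) *\<^sub>R x + t *\<^sub>R y) - u) (w - u) = (1 - t) * cr (x - u) (w - u) + t * cr (y - u) (w - u)"
    by (simp add: cr_def algebra_simps)
  then show ?thesis by (simp add: A_def add_divide_distrib)
qed

lemma B_affine: "B ((1 - t) *\<^sub>R x + t *\<^sub>R y) = (1 - t) * B x + t * B y"
proof -
  have "cr (v - u) (((1 - t) *\<^sub>R x + t *\<^sub>R y) - u) = (1 - t) * cr (v - u) (x - u) + t * cr (v - u) (y - u)"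
    by (simp add: cr_def algebra_simps)
  then show ?thesis by (simp add: B_def add_divide_distrib)
qed

lemma eq_iff_coords: "p = q \<longleftrightarrow> A p = A q \<and> B p = B q"
  using decomp[of p] decomp[of q] by (metis diff_eq_eq)

lemma A_zero: assumes "p \<in> P" "A p = 0" "p \<noteq> u" shows "p = w"
proof (rule ccontr)
  assume "p \<noteq> w"
  then have "cr (p - u) (w - u) \<noteq> 0" using nc[OF uP assms(1) wP] assms uw by auto
  then show False using assms D0 by (simp add: A_def)
qed

lemma B_zero: assumes "p \<in> P" "B p = 0" "p \<noteq> u" shows "p = v"
proof (rule ccontr)
  assume "p \<noteq> v"
  then have "cr (v - u) (p - u) \<noteq> 0" using nc[OF uP vP assms(1)] assms uv by auto
  then show False using assms D0 by (simp add: B_def)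
qed

lemma constraint_avoids_u:
  assumes "is_constraint S a b" shows "u \<notin> open_segment a b"
proof
  assume *: "u \<in> open_segment a b"
  then obtain t where t: "0 < t" "t < 1" "u = (1 - t) *\<^sub>R a + t *\<^sub>R b" and ab: "a \<noteq> b"
    by (auto simp: in_segment)
  have "u \<noteq> a" "u \<noteq> b" using * by (auto simp: open_segment_def)
  moreover have "a \<in> P" "b \<in> P"
    using assms cons unfolding is_constraint_def constraints_on_def by auto
  moreover have "cr (u - a) (b - a) = 0"
    unfolding t(3) by (simp add: cr_def algebra_simps)
  ultimately show False using nc[of a u b] uP ab by auto
qed

text \<open>A constraint meeting the wedge below the line \<open>L A + M B = 1\<close> can neither end there nor
  leave through one of the visible sides.\<close>
lemma no_low_endpoint:
  assumes L: "1 \<le> L" and M: "1 \<le> M"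
    and low: "\<And>p. p \<in> P \<Longrightarrow> p \<noteq> u \<Longrightarrow> 0 \<le> A p \<Longrightarrow> 0 \<le> B p \<Longrightarrow> 1 \<le> L * A p + M * B p"
    and c: "is_constraint S a e" and x: "x \<in> open_segment a e"
    and Ax: "0 < A x" and Bx: "0 < B x" and fx: "L * A x + M * B x \<le> 1"
  shows "1 \<le> L * A e + M * B e"
proof (rule ccontr)
  assume fe: "\<not> 1 \<le> L * A e + M * B e"
  have P: "a \<in> P" "e \<in> P"
    using c cons unfolding is_constraint_def constraints_on_def by auto
  obtain r where r: "0 < r" "r < 1" "x = (1 - r) *\<^sub>R a + r *\<^sub>R e"
    using x by (auto simp: in_segment)
  \<comment> \<open>The point \<open>y t\<close> moves from \<open>x\<close> to the end
    \<open>e\<close> strictly below the line. As \<open>L\<close> and \<open>M\<close> are at least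
    1, it could meet a side of the wedge only at \<open>u\<close> or on one of the sight
    lines.\<close>
  define y where "y t = (1 - t) *\<^sub>R x + t *\<^sub>R e" for t :: real
  have yA: "A (y t) = (1 - t) * A x + t * A e" and yB: "B (y t) = (1 - t) * B x + t * B e" for t
    by (simp_all add: y_def A_affine B_affine)
  have yo: "y t \<in> open_segment a e" if "0 < t" "t < 1" for t
    unfolding y_def using open_segment_shrink[OF x that] .
  have yf: "L * A (y t) + M * B (y t) < 1" if "0 < t" "t < 1" for t
  proof -
    have "L * A (y t) + M * B (y t) = (1 - t) * (L * A x + M * B x) + t * (L * A e + M * B e)"
      by (simp add: yA yB algebra_simps)
    also have "\<dots> < (1 - t) * 1 + t * 1"
      using fx fe that by (intro add_le_less_mono mult_left_mono mult_strict_left_mono) auto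
    finally show ?thesis by simp
  qed
  have noA: False if t: "0 < t" "t < 1" and A0: "A (y t) = 0" and B0: "0 \<le> B (y t)" for t
  proof (cases "B (y t) = 0")
    case True
    then have "y t = u" using A0 eq_iff_coords by auto
    then show False using constraint_avoids_u[OF c] yo[OF t] by simp
  next
    case False
    have "M * B (y t) < 1" using yf[OF t] A0 by simp
    moreover have "1 * B (y t) \<le> M * B (y t)" using M B0 by (intro mult_right_mono)
    ultimately have "B (y t) < 1" by simp
    moreover have "y t = (1 - B (y t)) *\<^sub>R u + B (y t) *\<^sub>R w"
      using decomp[of "y t"] A0 by (simp add: algebra_simps)
    ultimately have "y t \<in> open_segment u w"
      using False B0 uw unfolding in_segment by (metis order_le_less)
    from visible_not_crossed[OF cons suw c this yo[OF t]]
    have "A a = 0 \<and> A e = 0" by (auto simp: doubleton_eq_iff)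
    then show False using Ax r by (simp add: A_affine)
  qed
  have noB: False if t: "0 < t" "t < 1" and A0: "B (y t) = 0" and B0: "0 \<le> A (y t)" for t
  proof (cases "A (y t) = 0")
    case True
    then have "y t = u" using A0 eq_iff_coords by auto
    then show False using constraint_avoids_u[OF c] yo[OF t] by simp
  next
    case False
    have "L * A (y t) < 1" using yf[OF t] A0 by simp
    moreover have "1 * A (y t) \<le> L * A (y t)" using L B0 by (intro mult_right_mono)
    ultimately have "A (y t) < 1" by simp
    moreover have "y t = (1 - A (y t)) *\<^sub>R u + A (y t) *\<^sub>R v"
      using decomp[of "y t"] A0 by (simp add: algebra_simps)
    ultimately have "y t \<in> open_segment u v"
      using False B0 uv unfolding in_segment by (metis order_le_less)
    from visible_not_crossed[OF cons suv c this yo[OF t]]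
    have "B a = 0 \<and> B e = 0" by (auto simp: doubleton_eq_iff)
    then show False using Bx r by (simp add: B_affine)
  qed
  show False
  \<comment> \<open>An end inside the wedge below the line is \<open>u\<close>, and then the
    constraint contradicts \<open>nocon\<close>. Otherwise the constraint leaves through a
    side.\<close>
  proof (cases "0 \<le> A e \<and> 0 \<le> B e")
    case True
    then have eu: "e = u" using low[OF P(2)] fe by auto
    have "A x = (1 - r) * A a" "B x = (1 - r) * B a"
      using r eu by (simp_all add: A_affine B_affine)
    then have "0 < A a" "0 < B a"
      using Ax Bx r by (simp_all add: zero_less_mult_iff)
    then show False using nocon[OF P(1) _ decomp] c eu by (auto simp: is_constraint_def)
  next
    case False
    \<comment> \<open>The parameters at which \<open>y\<close> reaches \<open>A = 0\<close> and
      \<open>B = 0\<close>. If both are reached, the smaller one is the exit, where the other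
      coordinate is still nonnegative.\<close>
    define tA where "tA = A x / (A x - A e)"
    define tB where "tB = B x / (B x - B e)"
    have tA: "0 < tA" "tA < 1" "A (y tA) = 0" if "A e < 0"
      using that Ax by (auto simp: tA_def yA field_simps)
    have tB: "0 < tB" "tB < 1" "B (y tB) = 0" if "B e < 0"
      using that Bx by (auto simp: tB_def yB field_simps)
    have posA: "0 \<le> A (y t)" if "0 \<le> t" "t \<le> 1" "0 \<le> A e" for t
      using that Ax by (simp add: yA)
    have posB: "0 \<le> B (y t)" if "0 \<le> t" "t \<le> 1" "0 \<le> B e" for t
      using that Bx by (simp add: yB)
    consider "A e < 0" "0 \<le> B e" | "B e < 0" "0 \<le> A e" | "A e < 0" "B e < 0" "tA \<le> tB" | "A e < 0" "B e < 0" "tB \<le> tA"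
      using False by linarith
    then show False
    proof cases
      case 1 then show False using noA[OF tA] posB tA by simp
    next
      case 2 then show False using noB[OF tB] posA tB by simp
    next
      case 3
      have "B (y tA) - B (y tB) = (tB - tA) * (B x - B e)" by (simp add: yB algebra_simps)
      also have "\<dots> \<ge> 0" using 3 Bx by (intro mult_nonneg_nonneg) auto
      finally show False using noA[OF tA] tB 3 by simp
    next
      case 4
      have "A (y tB) - A (y tA) = (tA - tB) * (A x - A e)" by (simp add: yA algebra_simps)
      also have "\<dots> \<ge> 0" using 4 Ax by (intro mult_nonneg_nonneg) auto
      finally show False using noB[OF tB] tA 4 by simp
    qed
  qed
qed

text \<open>A constraint crossing \<open>uq\<close> does so where \<open>L * A + M * B\<close> is
  below 1. Both its ends have value at least 1, hence so has every point between them, the crossing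
  included.\<close>

lemma lowest_visible:
  assumes L: "1 \<le> L" and M: "1 \<le> M"
    and low: "\<And>p. p \<in> P \<Longrightarrow> p \<noteq> u \<Longrightarrow> 0 \<le> A p \<Longrightarrow> 0 \<le> B p \<Longrightarrow> 1 \<le> L * A p + M * B p"
    and "0 < A q" "0 < B q" "L * A q + M * B q = 1"
  shows "sees S u q"
proof (rule seesI)
  fix a b x assume c: "is_constraint S a b" and x: "x \<in> open_segment u q" "x \<in> open_segment a b"
  obtain t where t: "0 < t" "t < 1" "x = (1 - t) *\<^sub>R u + t *\<^sub>R q"
    using x(1) by (auto simp: in_segment)
  obtain r where r: "0 < r" "r < 1" "x = (1 - r) *\<^sub>R a + r *\<^sub>R b"
    using x(2) by (auto simp: in_segment)
  have AB: "A x = t * A q" "B x = t * B q" using t by (simp_all add: A_affine B_affine)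
  have "L * A x + M * B x = t * (L * A q + M * B q)" by (simp add: AB algebra_simps)
  then have fx: "L * A x + M * B x = t" using assms by simp
  have pos: "0 < A x" "0 < B x" using AB t assms by auto
  have c': "is_constraint S b a" "x \<in> open_segment b a"
    using c x(2) by (auto simp: is_constraint_def open_segment_commute)
  have 1: "1 \<le> L * A b + M * B b" by (rule no_low_endpoint[OF L M low c x(2) pos]) (use fx t in auto)
  have 2: "1 \<le> L * A a + M * B a" by (rule no_low_endpoint[OF L M low c' pos]) (use fx t in auto)
  have "t = L * A x + M * B x" using fx by simp
  also have "\<dots> = (1 - r) * (L * A a + M * B a) + r * (L * A b + M * B b)"
    unfolding r(3) A_affine B_affine by (simp add: algebra_simps)
  also have "\<dots> \<ge> (1 - r) * 1 + r * 1"
    using 1 2 r by (intro add_mono mult_left_mono) auto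
  finally show "{a, b} = {u, q}" using t by simp
qed

text \<open>The segment \<open>vq\<close> lies on the supporting line. A constraint crossing it has
  no end below that line, hence both ends on it, and general position leaves only \<open>v\<close>
  and \<open>q\<close> there.\<close>

lemma next_visible:
  assumes M: "1 \<le> M"
    and low: "\<And>p. p \<in> P \<Longrightarrow> p \<noteq> u \<Longrightarrow> 0 \<le> A p \<Longrightarrow> 0 \<le> B p \<Longrightarrow> 1 \<le> A p + M * B p"
    and q: "q \<in> P" "0 \<le> A q" "0 < B q" "A q + M * B q = 1"
  shows "sees S v q"
proof (rule seesI)
  fix a b x assume c: "is_constraint S a b" and x: "x \<in> open_segment v q" "x \<in> open_segment a b"
  have ab: "a \<in> P" "b \<in> P" "a \<noteq> b"
    using c cons unfolding is_constraint_def constraints_on_def by auto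
  obtain t where t: "0 < t" "t < 1" "x = (1 - t) *\<^sub>R v + t *\<^sub>R q"
    using x(1) by (auto simp: in_segment)
  obtain r where r: "0 < r" "r < 1" "x = (1 - r) *\<^sub>R a + r *\<^sub>R b"
    using x(2) by (auto simp: in_segment)
  have AB: "A x = (1 - t) + t * A q" "B x = t * B q" using t by (simp_all add: A_affine B_affine)
  have "A x + M * B x = (1 - t) + t * (A q + M * B q)" by (simp add: AB algebra_simps)
  then have fx: "1 * A x + M * B x = 1" using q by simp
  have "0 \<le> t * A q" using t q by simp
  then have "0 < A x" using AB(1) t(2) by linarith
  moreover have "0 < B x" using AB(2) t q by simp
  ultimately have pos: "0 < A x" "0 < B x" .
  have c': "is_constraint S b a" "x \<in> open_segment b a"
    using c x(2) by (auto simp: is_constraint_def open_segment_commute)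
  have low': "\<And>p. p \<in> P \<Longrightarrow> p \<noteq> u \<Longrightarrow> 0 \<le> A p \<Longrightarrow> 0 \<le> B p \<Longrightarrow> 1 \<le> 1 * A p + M * B p"
    using low by simp
  have 1: "1 \<le> A b + M * B b"
    using no_low_endpoint[OF order_refl M low' c x(2) pos] fx by simp
  have 2: "1 \<le> A a + M * B a"
    using no_low_endpoint[OF order_refl M low' c' pos] fx by simp
  have "A x + M * B x = (1 - r) * (A a + M * B a) + r * (A b + M * B b)"
    unfolding r(3) A_affine B_affine by (simp add: algebra_simps)
  then have e: "1 = (1 - r) * (A a + M * B a) + r * (A b + M * B b)" using fx by simp
  have "0 \<le> (1 - r) * (A a + M * B a - 1)" "0 \<le> r * (A b + M * B b - 1)" using 1 2 r by auto
  moreover have "(1 - r) * (A a + M * B a - 1) + r * (A b + M * B b - 1) = 0"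
    using e by (simp add: algebra_simps)
  ultimately have "(1 - r) * (A a + M * B a - 1) = 0" "r * (A b + M * B b - 1) = 0" by linarith+
  then have fa: "A a + M * B a = 1" and fb: "A b + M * B b = 1" using r by auto
  have vq: "v \<noteq> q" using q(3) coords_simps(4) by (metis less_irrefl)
  have on: "p = v \<or> p = q" if "p \<in> P" "A p + M * B p = 1" for p
  proof (rule ccontr)
    assume n: "\<not> (p = v \<or> p = q)"
    have *: "z - v = B z *\<^sub>R ((w - u) - M *\<^sub>R (v - u))" if "A z + M * B z = 1" for z
    proof -
      have Az: "A z = 1 - M * B z" using that by simp
      have "z - v = (z - u) - (v - u)" by simp
      also have "\<dots> = A z *\<^sub>R (v - u) + B z *\<^sub>R (w - u) - (v - u)" by (simp only: decomp[of z])
      finally show ?thesis unfolding Az by (simp add: algebra_simps)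
    qed
    have "cr (p - v) (q - v) = 0"
      unfolding *[OF that(2)] *[OF q(4)] by (simp add: cr_def)
    then show False using nc[OF vP that(1) q(1)] n vq by auto
  qed
  show "{a, b} = {v, q}" using on[OF ab(1) fa] on[OF ab(2) fb] ab(3) by auto
qed

text \<open>One step of gift wrapping: a line is turned about \<open>v\<close> until it supports the
  vertices of the wedge from below; \<open>q\<close> is the vertex it hits.\<close>

lemma gift_wrap:
  obtains q M where "q \<in> P" "q \<noteq> v" "1 \<le> M" "0 \<le> A q" "0 < B q" "A q + M * B q = 1"
    "\<And>p. p \<in> P \<Longrightarrow> p \<noteq> u \<Longrightarrow> 0 \<le> A p \<Longrightarrow> 0 \<le> B p \<Longrightarrow> 1 \<le> A p + M * B p"
    "sees S v q" "sees S u q" "q = w \<or> 0 < A q"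
proof -
  define W where "W = {p \<in> P. 0 \<le> A p \<and> 0 < B p}"
  \<comment> \<open>The slope of the line from \<open>v\<close> to \<open>p\<close> in the
    coordinates \<open>B\<close>, \<open>A\<close>, to be minimised. The slope for \<open>w\<close>
    is -1, whence \<open>1 \<le> M\<close>.\<close>
  define f where "f p = (A p - 1) / B p" for p
  have "finite W" "w \<in> W" using fin wP by (auto simp: W_def)
  then obtain q where q: "q \<in> W" "\<And>p. p \<in> W \<Longrightarrow> f q \<le> f p"
    using arg_min_if_finite[of W f] arg_min_least[of W _ f] by (metis empty_iff)
  define M where "M = - f q"
  have M: "1 \<le> M" using q(2)[OF \<open>w \<in> W\<close>] by (simp add: M_def f_def)
  have qq: "q \<in> P" "0 \<le> A q" "0 < B q" using q(1) by (auto simp: W_def)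
  have q1: "A q + M * B q = 1" using qq by (simp add: M_def f_def)
  have low: "1 \<le> A p + M * B p" if p: "p \<in> P" "p \<noteq> u" "0 \<le> A p" "0 \<le> B p" for p
  proof (cases "B p = 0")
    case True
    then show ?thesis using B_zero[OF p(1) True p(2)] by simp
  next
    case False
    then have "f q \<le> f p" using q(2) p by (simp add: W_def)
    then show ?thesis using False p by (simp add: M_def f_def[of p] field_simps)
  qed
  have Aq: "q = w \<or> 0 < A q" using A_zero[OF qq(1)] qq by force
  have "sees S u q"
  proof (cases "q = w")
    case False
    have low': "\<And>p. p \<in> P \<Longrightarrow> p \<noteq> u \<Longrightarrow> 0 \<le> A p \<Longrightarrow> 0 \<le> B p \<Longrightarrow> 1 \<le> 1 * A p + M * B p"
      using low by simp
    show ?thesis by (rule lowest_visible[OF order_refl M low']) (use False Aq qq q1 in auto)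
  qed (use suw in simp)
  moreover have "sees S v q" by (rule next_visible[OF M low]) (use qq q1 in auto)
  moreover have "q \<noteq> v" using qq by auto
  ultimately show ?thesis using that[of q M] qq M q1 low Aq by blast
qed

end

subsection \<open>Trigonometric estimates\<close>

text \<open>The first hypothesis says that 4k + 2 cones of half-angle \<open>t\<close> fill the
  circle. It turns the bound per unit length in direction \<open>x\<close> into a multiple of a
  cosine, symmetric about \<open>x = real k * t\<close>.\<close>

lemma spanning_bound_trig:
  fixes k :: nat and t :: real
  assumes "(2 * real k + 1) * t = pi / 2" "cos t \<noteq> 0"
  shows "(1 + sin t) / cos t * cos x + sin x = 2 * cos (real k * t) * cos (x - real k * t) / cos t"
proof -
  have "pi / 2 = 2 * real k * t + t" using assms(1) by (simp add: algebra_simps)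
  then have "pi / 2 - (t + x) = 2 * (real k * t) - x" by simp
  then have "sin (t + x) = cos (2 * (real k * t) - x)" using sin_cos_eq[of "t + x"] by (simp only: of_real_eq_id id_apply)
  moreover have "(x + (2 * (real k * t) - x)) / 2 = real k * t"
    "(x - (2 * (real k * t) - x)) / 2 = x - real k * t" by (simp_all add: field_simps)
  ultimately have "cos x + sin (t + x) = 2 * cos (real k * t) * cos (x - real k * t)"
    using cos_plus_cos[of x "2 * (real k * t) - x"] by (simp only:)
  moreover have "cos x + sin (t + x) = (1 + sin t) * cos x + cos t * sin x"
    by (simp add: sin_add algebra_simps)
  ultimately show ?thesis using assms(2) by (simp add: field_simps)
qed

text \<open>Here \<open>\<phi>\<close> is the direction of an edge relative to the bisector of C_0
  and \<open>\<psi>\<close> relative to that of its own cone. The hypotheses say that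
  \<open>\<phi>\<close> is no farther from \<open>real k * t\<close> than
  \<open>\<bar>\<psi>\<bar>\<close> is, and the cosine decreases with this distance.\<close>

lemma rotated_cone_bound:
  fixes k :: nat and t :: real
  assumes kt: "(2 * real k + 1) * t = pi / 2" and t: "0 < t"
    and "\<bar>\<psi>\<bar> \<le> \<phi>" "\<phi> + \<bar>\<psi>\<bar> \<le> 2 * real k * t"
  shows "(1 + sin t) / cos t * cos \<psi> + \<bar>sin \<psi>\<bar> \<le> (1 + sin t) / cos t * cos \<phi> + sin \<phi>"
proof -
  have e: "pi / 2 = 2 * (real k * t) + t" using kt by (simp add: algebra_simps)
  have kt0: "0 \<le> real k * t" using t by simp
  show ?thesis
  \<comment> \<open>This is \<open>k = 0\<close>, where \<open>cos t\<close> vanishes and both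
    angles are forced to be 0.\<close>
  proof (cases "t = pi / 2")
    case True
    then have "real k * t = 0" using e by simp
    then have "\<phi> = 0" "\<psi> = 0" using assms(3,4) by auto
    then show ?thesis by simp
  next
    case False
    then have "t < pi / 2" using e kt0 by linarith
    then have c: "0 < cos t" using t by (intro cos_gt_zero) auto
    have kc: "0 \<le> cos (real k * t)" by (rule cos_ge_zero; use e kt0 t in linarith)
    have a: "\<bar>sin \<psi>\<bar> = sin \<bar>\<psi>\<bar>"
    proof -
      have "0 \<le> sin \<bar>\<psi>\<bar>" using assms(3,4) e t by (intro sin_ge_zero) auto
      then show ?thesis by (auto simp: abs_if)
    qed
    have "cos (real k * t - \<bar>\<psi>\<bar>) \<le> cos \<bar>\<phi> - real k * t\<bar>"
      by (rule cos_monotone_0_pi_le) (use assms(3,4) e t in auto)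
    then have "cos (\<bar>\<psi>\<bar> - real k * t) \<le> cos (\<phi> - real k * t)"
      by (metis cos_abs_real cos_minus minus_diff_eq)
    then have "2 * cos (real k * t) * cos (\<bar>\<psi>\<bar> - real k * t) / cos t \<le> 2 * cos (real k * t) * cos (\<phi> - real k * t) / cos t"
      using kc c by (intro divide_right_mono mult_left_mono) auto
    then have "(1 + sin t) / cos t * cos \<bar>\<psi>\<bar> + sin \<bar>\<psi>\<bar> \<le> (1 + sin t) / cos t * cos \<phi> + sin \<phi>"
      using c by (simp only: spanning_bound_trig[OF kt less_imp_neq[OF c, symmetric]])
    then show ?thesis using a by simp
  qed
qed

text \<open>The angles \<open>\<phi>\<close> and \<open>- \<psi>\<close> are mirror images about
  \<open>real k * t\<close>, so the sharper bound in the last cone is exactly the bound wanted in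
  C_0.\<close>

lemma last_cone_bound:
  fixes k :: nat and t :: real
  assumes kt: "(2 * real k + 1) * t = pi / 2" and c: "cos t \<noteq> 0" and p: "\<phi> = 2 * real k * t + \<psi>"
  shows "(1 + sin t) / cos t * cos \<psi> - sin \<psi> = (1 + sin t) / cos t * cos \<phi> + sin \<phi>"
proof -
  have "- \<psi> - real k * t = - (\<phi> - real k * t)" using p by simp
  then have "cos (- \<psi> - real k * t) = cos (\<phi> - real k * t)" by (metis cos_minus)
  then have "(1 + sin t) / cos t * cos (- \<psi>) + sin (- \<psi>) = (1 + sin t) / cos t * cos \<phi> + sin \<phi>"
    by (simp only: spanning_bound_trig[OF kt c])
  then show ?thesis by simp
qed

text \<open>Makes the induction hypothesis available in a rotated cone: the canonical triangle of an
  edge with displacement \<open>x\<close>, \<open>h\<close> in C_j is lower than the height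
  \<open>H\<close> of the original one.\<close>

lemma rotated_proj_less:
  fixes j k :: nat and t :: real
  assumes kt: "(2 * real k + 1) * t = pi / 2" and t: "0 < t" and j: "1 \<le> j" "j \<le> k"
    and x: "x * cos t + h * sin t < 2 * H * sin t" and h: "h < H" "0 < H"
  shows "h * cos (2 * real j * t) + x * sin (2 * real j * t) < H"
proof -
  define a where "a = 2 * real j * t"
  have e: "pi / 2 = 2 * (real k * t) + t" using kt by (simp add: algebra_simps)
  have jk: "real j * t \<le> real k * t" "t \<le> real j * t" using j t by (auto simp: mult_right_mono)
  have a: "2 * t \<le> a" "a + t \<le> pi / 2" using jk e by (auto simp: a_def)
  have ct: "0 < cos t" using a t by (intro cos_gt_zero) auto
  have sa: "0 < sin a" using a t by (intro sin_gt_zero) auto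
  have cat: "0 \<le> cos (a + t)" using a t by (intro cos_ge_zero) auto
  \<comment> \<open>After multiplication by \<open>cos t\<close> the height is a combination of the
    two bounded quantities with nonnegative coefficients \<open>sin a\<close> and
    \<open>cos (a + t)\<close>.\<close>
  have "cos t * (h * cos a + x * sin a) = sin a * (x * cos t + h * sin t) + h * cos (a + t)"
    by (simp add: cos_add algebra_simps)
  also have "\<dots> < sin a * (2 * H * sin t) + H * cos (a + t)"
    using sa x h cat by (intro add_less_le_mono mult_strict_left_mono mult_right_mono) auto
  also have "\<dots> = H * cos (a - t)" by (simp add: cos_add cos_diff algebra_simps)
  also have "\<dots> \<le> H * cos t"
    using a t h by (intro mult_left_mono cos_monotone_0_pi_le) auto
  finally have "cos t * (h * cos a + x * sin a) < cos t * H" by (simp add: mult.commute)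
  then show ?thesis using ct by (simp add: a_def)
qed

text \<open>Polar coordinates of an ascending vector, with the angle rounded to the nearest
  bisector. An angle below \<open>pi / 2 = 2 * real k * t + t\<close> cannot round past C_k.\<close>

lemma cone_index:
  fixes k :: nat and t :: real
  assumes kt: "(2 * real k + 1) * t = pi / 2" and k: "1 \<le> k" and t: "0 < t"
    and h: "0 < h" and x: "- (tan t * h) < x"
  obtains j \<phi> \<psi> r where "0 < r" "h = r * cos \<phi>" "x = r * sin \<phi>" "j \<le> k"
    "\<phi> = 2 * real j * t + \<psi>" "- t \<le> \<psi>" "\<psi> < t" "\<phi> < pi / 2"
proof -
  have e: "pi / 2 = 2 * (real k * t) + t" using kt by (simp add: algebra_simps)
  have "t \<le> real k * t" using k t by simp
  then have t2: "t < pi / 2" using e t by linarith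
  define \<phi> where "\<phi> = arctan (x / h)"
  define r where "r = h / cos \<phi>"
  have \<phi>: "- (pi / 2) < \<phi>" "\<phi> < pi / 2" using arctan_bounded[of "x / h"] by (auto simp: \<phi>_def)
  have c: "0 < cos \<phi>" using \<phi> by (intro cos_gt_zero_pi) auto
  have "tan (- t) < x / h" using x h by (simp add: field_simps)
  then have "arctan (tan (- t)) < \<phi>" unfolding \<phi>_def by (rule arctan_monotone)
  then have "- t < \<phi>" using arctan_tan[of "- t"] t t2 by simp
  define j where "j = nat \<lfloor>(\<phi> + t) / (2 * t)\<rfloor>"
  have p: "0 \<le> (\<phi> + t) / (2 * t)" using \<open>- t < \<phi>\<close> t by simp
  have j: "real j \<le> (\<phi> + t) / (2 * t)" "(\<phi> + t) / (2 * t) < real j + 1"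
    using p by (auto simp: j_def of_nat_nat)
  then have j1: "2 * real j * t \<le> \<phi> + t" "\<phi> + t < 2 * real j * t + 2 * t"
    using t by (auto simp: field_simps)
  have "2 * real j * t < 2 * real k * t + 2 * t" using j1 \<phi> e by linarith
  then have "2 * t * real j < 2 * t * real (k + 1)" by (simp add: algebra_simps)
  then have "real j < real (k + 1)" using t by simp
  then have "j \<le> k" by simp
  show ?thesis
  proof (rule that[of r \<phi> j "\<phi> - 2 * real j * t"])
    show "0 < r" using h c by (simp add: r_def)
    show "h = r * cos \<phi>" using c by (simp add: r_def)
    have "sin \<phi> / cos \<phi> = x / h" unfolding \<phi>_def by (metis tan_arctan tan_def)
    then show "x = r * sin \<phi>" using c h by (simp add: r_def field_simps)
  qed (use j1 \<phi> \<open>j \<le> k\<close> in auto)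
qed

subsection \<open>Cones and subcones\<close>

text \<open>Linear inequalities in place of \<open>Arg\<close> reduce convexity and rotation of
  cones to algebra; \<open>e\<close> is the unit vector of the bisector and \<open>t\<close> the
  half-angle.\<close>

definition sector :: "real \<Rightarrow> complex \<Rightarrow> complex \<Rightarrow> bool" where
  "sector t e z \<longleftrightarrow> 0 < Re (z * cnj e) \<and> \<bar>Im (z * cnj e)\<bar> < tan t * Re (z * cnj e)"

definition bisectors :: "nat \<Rightarrow> complex set" where
  "bisectors n = bis n ` {..<n}"

lemma bisectors_iff:
  assumes "0 < n"
  shows "e \<in> bisectors n \<longleftrightarrow> (\<exists>m::int. e = cis (pi / 2 - of_int m * cone_angle n))"
proof
  assume "e \<in> bisectors n"
  then obtain i where "e = bis n i" by (auto simp: bisectors_def)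
  then have "e = cis (pi / 2 - of_int (int i) * cone_angle n)" by (simp add: bis_def dir_def)
  then show "\<exists>m::int. e = cis (pi / 2 - of_int m * cone_angle n)" by blast
next
  assume "\<exists>m::int. e = cis (pi / 2 - of_int m * cone_angle n)"
  then obtain m :: int where m: "e = cis (pi / 2 - of_int m * cone_angle n)" by blast
  define i where "i = nat (m mod int n)"
  have i: "i < n" "int i = m mod int n" using assms by (auto simp: i_def nat_less_iff)
  have "real_of_int m = real n * of_int (m div int n) + real i"
    using i(2) by (metis mult_div_mod_eq of_int_add of_int_mult of_int_of_nat_eq)
  then have "of_int m * cone_angle n = 2 * pi * of_int (m div int n) + real i * cone_angle n"
    using assms by (simp add: cone_angle_def field_simps)
  then have "e = cis ((pi / 2 - real i * cone_angle n) - 2 * pi * of_int (m div int n))"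
    unfolding m by (simp add: algebra_simps)
  also have "\<dots> = cis (pi / 2 - real i * cone_angle n)"
    by (simp add: cis_divide[symmetric] cis_multiple_2pi)
  finally have "e = bis n i" by (simp add: bis_def dir_def)
  then show "e \<in> bisectors n" using i(1) by (auto simp: bisectors_def)
qed

lemma bisectors_rotate:
  assumes "0 < n" "e \<in> bisectors n"
  shows "e * cis (of_int m * cone_angle n) \<in> bisectors n"
proof -
  obtain l :: int where "e = cis (pi / 2 - of_int l * cone_angle n)"
    using assms(2) unfolding bisectors_iff[OF assms(1)] ..
  then have "e * cis (of_int m * cone_angle n) = cis (pi / 2 - of_int (l - m) * cone_angle n)"
    by (simp add: cis_mult algebra_simps)
  then show ?thesis unfolding bisectors_iff[OF assms(1)] ..
qed

text \<open>With an even number of cones the half turn permutes the bisectors, so an edge can be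
  viewed from its other endpoint in the opposite cone.\<close>

lemma bisectors_minus:
  assumes "0 < n" "even n" "e \<in> bisectors n"
  shows "- e \<in> bisectors n"
proof -
  obtain m where m: "n = 2 * m" using assms(2) by (elim evenE)
  have "of_int (int m) * cone_angle n = pi" using assms(1) unfolding m by (simp add: cone_angle_def)
  then have "e * cis (of_int (int m) * cone_angle n) = - e" by (simp only: cis_pi mult_minus1_right)
  with bisectors_rotate[OF assms(1,3), of "int m"] show ?thesis by (simp only:)
qed

lemma bisectors_norm: "e \<in> bisectors n \<Longrightarrow> cmod e = 1"
  by (auto simp: bisectors_def bis_def dir_def)

lemma general_position_bisectors:
  assumes "general_position n P" "0 < n" "e \<in> bisectors n" "p \<in> P" "q \<in> P" "p \<noteq> q"
  shows "Re ((q - p) * cnj e) \<noteq> 0"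
    and "Im ((q - p) * cnj (e * cis (cone_angle n / 2))) \<noteq> 0"
    and "Im ((q - p) * cnj (e * cis (- (cone_angle n / 2)))) \<noteq> 0"
proof -
  show "Re ((q - p) * cnj e) \<noteq> 0"
    using assms unfolding general_position_def bisectors_def by blast
  \<comment> \<open>General position speaks of the clockwise boundary ray of each cone; the
    counterclockwise one is the clockwise boundary of the neighbouring cone.\<close>
  have *: "Im ((q - p) * cnj (e' * cis (- (cone_angle n / 2)))) \<noteq> 0" if e': "e' \<in> bisectors n" for e'
  proof -
    obtain j where j: "j < n" "e' = bis n j" using e' by (auto simp: bisectors_def)
    have "e' * cis (- (cone_angle n / 2)) = dir ((real j + 1 / 2) * cone_angle n)"
      unfolding j(2) by (simp add: bis_def dir_def cis_mult algebra_simps)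
    moreover have "Im ((q - p) * cnj (dir ((real j + 1 / 2) * cone_angle n))) \<noteq> 0"
      using assms(1,4-6) j(1) unfolding general_position_def by blast
    ultimately show ?thesis by (simp only: not_False_eq_True)
  qed
  show "Im ((q - p) * cnj (e * cis (- (cone_angle n / 2)))) \<noteq> 0" by (rule *[OF assms(3)])
  have "e * cis (of_int 1 * cone_angle n) * cis (- (cone_angle n / 2)) = e * cis (cone_angle n / 2)"
    by (simp add: cis_mult mult.assoc)
  then show "Im ((q - p) * cnj (e * cis (cone_angle n / 2))) \<noteq> 0"
    using *[OF bisectors_rotate[OF assms(2,3), of 1]] by (simp only: not_False_eq_True)
qed

lemma divide_unit: "cmod e = 1 \<Longrightarrow> z / e = z * cnj e"
  using complex_div_cnj[of z e] by simp

lemma bis_norm: "cmod (bis n i) = 1"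
  by (simp add: bis_def dir_def)

text \<open>For more than two cones the half-angle is below \<open>pi / 2\<close>, so
  \<open>Arg\<close> is the arctangent of a slope throughout the cone.\<close>

lemma in_cone_iff:
  assumes "2 < n"
  shows "in_cone n i u w \<longleftrightarrow> sector (cone_angle n / 2) (bis n i) (w - u)"
    and "sector (cone_angle n / 2) (bis n i) (w - u) \<Longrightarrow>
      offs n i u w = arctan (Im ((w - u) * cnj (bis n i)) / Re ((w - u) * cnj (bis n i)))"
proof -
  define t where "t = cone_angle n / 2"
  have t: "0 < t" "t < pi / 2" using assms by (auto simp: t_def cone_angle_def field_simps)
  define z where "z = (w - u) * cnj (bis n i)"
  have o: "offs n i u w = Arg z" by (simp add: offs_def z_def divide_unit[OF bis_norm])
  have z0: "z = 0 \<longleftrightarrow> w = u" using bis_norm[of n i] by (auto simp: z_def)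
  have at: "\<bar>arctan y\<bar> < t \<longleftrightarrow> \<bar>y\<bar> < tan t" for y
  proof -
    have "arctan (tan t) = t" using t by (intro arctan_tan) auto
    moreover have "\<bar>arctan y\<bar> = arctan \<bar>y\<bar>" by (simp add: abs_if arctan_minus)
    ultimately show ?thesis by (metis arctan_less_iff)
  qed
  have ar: "Arg z = arctan (Im z / Re z)" if "0 < Re z"
    using arg_conv_arctan[OF that] .
  show "in_cone n i u w \<longleftrightarrow> sector (cone_angle n / 2) (bis n i) (w - u)"
  proof (cases "0 < Re z")
    case True
    then have "\<bar>Im z / Re z\<bar> < tan t \<longleftrightarrow> \<bar>Im z\<bar> < tan t * Re z"
      by (simp add: abs_divide field_simps)
    moreover have "w \<noteq> u" using True z0 by auto
    ultimately show ?thesis using True at[of "Im z / Re z"] ar[OF True]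
      by (simp add: in_cone_def sector_def o t_def[symmetric] z_def[symmetric])
  next
    case False
    have "\<not> \<bar>Arg z\<bar> < t" if "w \<noteq> u"
    proof
      assume "\<bar>Arg z\<bar> < t"
      then have "0 < Re z" using t z0 that Arg_Re_pos[of z] by auto
      then show False using False by simp
    qed
    then show ?thesis using False
      by (auto simp: in_cone_def sector_def o t_def[symmetric] z_def[symmetric])
  qed
  show "sector (cone_angle n / 2) (bis n i) (w - u) \<Longrightarrow>
      offs n i u w = arctan (Im ((w - u) * cnj (bis n i)) / Re ((w - u) * cnj (bis n i)))"
    using ar by (simp add: sector_def o z_def)
qed

lemma subcone_exists:
  assumes "finite P" "in_cone n i u w"
  obtains lo hi where "is_subcone P S n i u lo hi" "lo \<le> offs n i u w" "offs n i u w \<le> hi"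
proof -
  define B where "B = sub_bounds P S n i u"
  define x where "x = offs n i u w"
  have "finite {offs n i u v | v. v \<in> P \<and> is_constraint S u v \<and> in_cone n i u v}"
    by (rule finite_subset[of _ "offs n i u ` P"]) (use assms in auto)
  then have fin: "finite B" by (simp add: B_def sub_bounds_def)
  have b: "- cone_angle n / 2 \<in> {b \<in> B. b \<le> x}" "cone_angle n / 2 \<in> {b \<in> B. x < b}"
    using assms(2) by (auto simp: B_def sub_bounds_def x_def in_cone_def)
  define lo where "lo = Max {b \<in> B. b \<le> x}"
  define hi where "hi = Min {b \<in> B. x < b}"
  have lo: "lo \<in> {b \<in> B. b \<le> x}" unfolding lo_def by (rule Max_in) (use fin b in auto)
  have hi: "hi \<in> {b \<in> B. x < b}" unfolding hi_def by (rule Min_in) (use fin b in auto)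
  have "False" if "c \<in> B" "lo < c" "c < hi" for c
  proof (cases "c \<le> x")
    case True
    then have "c \<le> lo" unfolding lo_def using that fin by (intro Max_ge) auto
    then show False using that by simp
  next
    case False
    then have "hi \<le> c" unfolding hi_def using that fin by (intro Min_le) auto
    then show False using that by simp
  qed
  then have "is_subcone P S n i u lo hi"
    unfolding is_subcone_def B_def[symmetric] using lo hi by auto
  then show ?thesis using that[of lo hi] lo hi by (auto simp: x_def)
qed

text \<open>A point strictly between the rays to \<open>v\<close> and \<open>w\<close> has its
  offset strictly inside their common subcone. Hence no constraint from \<open>u\<close> ends there,
  and the minimality of \<open>v\<close> applies to it if it is visible.\<close>

lemma closest_visible:
  assumes "2 < n" "finite P" "u \<in> P" "w \<in> P" "sees S u w" "e \<in> bisectors n"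
    and "sector (cone_angle n / 2) e (w - u)"
  obtains v where "v \<in> P" "theta_edge P S n u v" "sees S u v" "sector (cone_angle n / 2) e (v - u)"
    "Re ((v - u) * cnj e) \<le> Re ((w - u) * cnj e)"
    "\<And>p a b. p \<in> P \<Longrightarrow> p - u = a *\<^sub>R (v - u) + b *\<^sub>R (w - u) \<Longrightarrow> 0 < a \<Longrightarrow> 0 < b \<Longrightarrow>
       cr (v - u) (w - u) \<noteq> 0 \<Longrightarrow>
       \<not> is_constraint S u p \<and> (sees S u p \<longrightarrow> Re ((v - u) * cnj e) \<le> Re ((p - u) * cnj e))"
proof -
  obtain i where i: "i < n" "e = bis n i" using assms(6) by (auto simp: bisectors_def)
  have wc: "in_cone n i u w" using assms(7) in_cone_iff(1)[OF assms(1)] i by simp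
  obtain lo hi where lh: "is_subcone P S n i u lo hi" "lo \<le> offs n i u w" "offs n i u w \<le> hi"
    using subcone_exists[OF assms(2) wc] by metis
  define V where "V = {p \<in> subcone_pts P n i u lo hi. sees S u p}"
  have "finite V" "w \<in> V" using assms wc lh by (auto simp: V_def subcone_pts_def)
  then obtain v where v: "v \<in> V" "\<And>p. p \<in> V \<Longrightarrow> proj n i u v \<le> proj n i u p"
    using arg_min_if_finite[of V "proj n i u"] arg_min_least[of V _ "proj n i u"] by (metis empty_iff)
  have vs: "v \<in> subcone_pts P n i u lo hi" "sees S u v" using v(1) by (auto simp: V_def)
  then have vP: "v \<in> P" and vc: "in_cone n i u v" and vo: "lo \<le> offs n i u v" "offs n i u v \<le> hi"
    by (auto simp: subcone_pts_def)
  have cv: "sector (cone_angle n / 2) e (v - u)" using vc in_cone_iff(1)[OF assms(1)] i by simp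
  have pr: "proj n i u p = Re ((p - u) * cnj e)" for p by (simp add: proj_def i)
  have de: "dir_edge P S n u v"
    unfolding dir_edge_def using i(1) lh(1) vs v(2) by (auto simp: V_def)
  show ?thesis
  proof (rule that[of v])
    show "theta_edge P S n u v" using de vP assms by (simp add: theta_edge_def)
    show "Re ((v - u) * cnj e) \<le> Re ((w - u) * cnj e)" using v(2)[OF \<open>w \<in> V\<close>] by (simp add: pr)
    fix p a b
    assume p: "p \<in> P" and ab: "p - u = a *\<^sub>R (v - u) + b *\<^sub>R (w - u)" "0 < a" "0 < b"
      and D: "cr (v - u) (w - u) \<noteq> 0"
    define R where "R q = Re ((q - u) * cnj e)" for q
    define J where "J q = Im ((q - u) * cnj e)" for q
    have Rp: "R p = a * R v + b * R w" and Jp: "J p = a * J v + b * J w"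
      unfolding R_def J_def ab(1) by (simp_all add: algebra_simps)
    have pos: "0 < R v" "0 < R w" "\<bar>J v\<bar> < tan (cone_angle n / 2) * R v" "\<bar>J w\<bar> < tan (cone_angle n / 2) * R w"
      using cv assms(7) by (auto simp: sector_def R_def J_def)
    have Rp0: "0 < R p" using Rp pos ab by (simp add: add_pos_pos)
    have "\<bar>J p\<bar> \<le> a * \<bar>J v\<bar> + b * \<bar>J w\<bar>"
      unfolding Jp using ab abs_triangle_ineq[of "a * J v" "b * J w"] by (simp add: abs_mult)
    also have "\<dots> < a * (tan (cone_angle n / 2) * R v) + b * (tan (cone_angle n / 2) * R w)"
      using pos ab by (intro add_strict_mono mult_strict_left_mono) auto
    also have "\<dots> = tan (cone_angle n / 2) * R p" by (simp add: Rp algebra_simps)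
    finally have cp: "sector (cone_angle n / 2) e (p - u)" using Rp0 by (simp add: sector_def R_def J_def)
    have pc: "in_cone n i u p" using cp in_cone_iff(1)[OF assms(1)] i by simp
    have o: "offs n i u q = arctan (J q / R q)" if "sector (cone_angle n / 2) e (q - u)" for q
      using in_cone_iff(2)[OF assms(1), of i q u] that i by (simp add: J_def R_def)
    have e1: "(Re e)\<^sup>2 + (Im e)\<^sup>2 = 1"
      using bisectors_norm[OF assms(6)] by (simp add: cmod_def)
    have "R v * J w - J v * R w = cr (v - u) (w - u) * ((Re e)\<^sup>2 + (Im e)\<^sup>2)"
      by (simp add: R_def J_def cr_def power2_eq_square algebra_simps)
    then have ne: "R v * J w - J v * R w \<noteq> 0" using D e1 by simp
    \<comment> \<open>These two identities put the slope \<open>J p / R p\<close> strictly between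
      those of \<open>v\<close> and \<open>w\<close>, in either order.\<close>
    have d1: "J p * R v - J v * R p = b * (R v * J w - J v * R w)"
      by (simp add: Rp Jp algebra_simps)
    have d2: "J w * R p - J p * R w = a * (R v * J w - J v * R w)"
      by (simp add: Rp Jp algebra_simps)
    have "lo < offs n i u p \<and> offs n i u p < hi"
    proof (cases "0 < R v * J w - J v * R w")
      case True
      then have "0 < J p * R v - J v * R p" "0 < J w * R p - J p * R w" using d1 d2 ab by simp_all
      then have "J v / R v < J p / R p" "J p / R p < J w / R w"
        using pos Rp0 by (simp_all add: field_simps)
      then have "offs n i u v < offs n i u p" "offs n i u p < offs n i u w"
        by (simp_all add: o cv cp assms(7) arctan_less_iff)
      then show ?thesis using vo lh by linarith
    next
      case False
      then have "0 < - (R v * J w - J v * R w)" using ne by linarith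
      then have "0 < b * - (R v * J w - J v * R w)" "0 < a * - (R v * J w - J v * R w)"
        using ab by (auto intro: mult_pos_pos)
      then have "0 < J v * R p - J p * R v" "0 < J p * R w - J w * R p" using d1 d2 by (simp_all add: algebra_simps)
      then have "J p / R p < J v / R v" "J w / R w < J p / R p"
        using pos Rp0 by (simp_all add: field_simps)
      then have "offs n i u p < offs n i u v" "offs n i u w < offs n i u p"
        by (simp_all add: o cv cp assms(7) arctan_less_iff)
      then show ?thesis using vo lh by linarith
    qed
    note bet = this
    have "\<not> is_constraint S u p"
    proof
      assume "is_constraint S u p"
      then have "offs n i u p \<in> sub_bounds P S n i u" using p pc by (auto simp: sub_bounds_def)
      then show False using lh(1) bet by (auto simp: is_subcone_def)
    qed
    moreover have "Re ((v - u) * cnj e) \<le> Re ((p - u) * cnj e)" if "sees S u p"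
    proof -
      have "p \<in> V" using that p pc bet by (simp add: V_def subcone_pts_def)
      from v(2)[OF this] show ?thesis by (simp add: pr)
    qed
    ultimately show "\<not> is_constraint S u p \<and> (sees S u p \<longrightarrow> Re ((v - u) * cnj e) \<le> Re ((p - u) * cnj e))"
      by blast
  qed (use vP vs cv in auto)
qed

subsection \<open>The induction\<close>

lemma sector_add: "sector t e y \<Longrightarrow> sector t e z \<Longrightarrow> sector t e (y + z)"
  unfolding sector_def by (auto simp: algebra_simps)

section \<open>The graph with 4k + 2 cones and the induction claim\<close>

locale theta_graph =
  fixes k n :: nat and P :: "complex set" and S :: "(complex \<times> complex) set" and t K :: real
  assumes k: "1 \<le> k" and n: "n = 4 * k + 2"
    and fin: "finite P" and gp: "general_position n P" and cons: "constraints_on P S"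
    and t_def: "t = cone_angle n / 2" and K_def: "K = (1 + sin t) / cos t"
begin

lemma kt: "(2 * real k + 1) * t = pi / 2"
  by (simp add: t_def cone_angle_def n field_simps)

lemma t_pos: "0 < t" and t3: "3 * t \<le> pi / 2"
proof -
  show "0 < t" by (simp add: t_def cone_angle_def n)
  then have "3 * t \<le> (2 * real k + 1) * t" using k by (intro mult_right_mono) auto
  then show "3 * t \<le> pi / 2" using kt by simp
qed

lemma t_half: "t < pi / 2" using t_pos t3 by linarith

lemma cos_t: "0 < cos t" using t_pos t_half by (intro cos_gt_zero) auto

lemma sin_t: "0 < sin t" using t_pos t_half by (intro sin_gt_zero) auto

lemma n2: "2 < n" using k n by simp

lemma cone_angle_t: "cone_angle n = 2 * t" by (simp add: t_def)

lemma nc: "p \<in> P \<Longrightarrow> q \<in> P \<Longrightarrow> r \<in> P \<Longrightarrow> p \<noteq> q \<Longrightarrow> q \<noteq> r \<Longrightarrow> p \<noteq> r \<Longrightarrow> cr (q - p) (r - p) \<noteq> 0"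
  using gp cr_zero_imp_collinear unfolding general_position_def by metis

text \<open>The value \<open>s = 1\<close> selects the part of the canonical triangle
  counterclockwise of \<open>uw\<close>, the value \<open>s = -1\<close> the other part.\<close>

definition side_empty :: "real \<Rightarrow> complex \<Rightarrow> complex \<Rightarrow> complex \<Rightarrow> bool" where
  "side_empty s e u w \<longleftrightarrow> (\<forall>p \<in> P. sector t e (p - u) \<longrightarrow>
     Re ((p - u) * cnj e) < Re ((w - u) * cnj e) \<longrightarrow> \<not> 0 < s * cr (w - u) (p - u))"

text \<open>If \<open>a\<close> and \<open>b\<close> are the corners of the triangle, then |ua| +
  |aw| and |ub| + |bw| are \<open>K\<close> times the height minus or plus the signed offset from
  the bisector; the absolute value yields their maximum. If one side is empty, the opposite corner
  alone gives the bound.\<close>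

definition short :: "complex \<Rightarrow> complex \<Rightarrow> complex \<Rightarrow> bool" where
  "short e u w \<longleftrightarrow>
     conn P S n u w (K * Re ((w - u) * cnj e) + \<bar>Im ((w - u) * cnj e)\<bar>) \<and>
     (\<forall>s \<in> {1, -1}. side_empty s e u w \<longrightarrow>
        conn P S n u w (K * Re ((w - u) * cnj e) + s * Im ((w - u) * cnj e)))"

end

section \<open>Reflected coordinates in the cone of \<open>u\<close>, and the rotated cones\<close>

locale descent = theta_graph +
  fixes e u w :: complex and s :: real
  assumes eD: "e \<in> bisectors n" and s: "s = 1 \<or> s = -1"
    and uP: "u \<in> P" and wP: "w \<in> P" and suw: "sees S u w" and cw: "sector t e (w - u)"
    and IH: "\<And>e' a b. e' \<in> bisectors n \<Longrightarrow> a \<in> P \<Longrightarrow> b \<in> P \<Longrightarrow> sees S a b \<Longrightarrow>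
      sector t e' (b - a) \<Longrightarrow> Re ((b - a) * cnj e') < Re ((w - u) * cnj e) \<Longrightarrow> short e' a b"
begin

text \<open>Height and horizontal position in the cone of \<open>u\<close>; the sign \<open>s\<close> reflects the picture such that
  the closest visible vertex always lies to the left of \<open>uw\<close>.\<close>

definition H :: "complex \<Rightarrow> real" where "H p = Re ((p - u) * cnj e)"

definition X :: "complex \<Rightarrow> real" where "X p = - s * Im ((p - u) * cnj e)"

lemma ss: "s * s = 1" using s by auto

lemma Hu [simp]: "H u = 0" and Xu [simp]: "X u = 0" by (simp_all add: H_def X_def)

lemma H_comb:
  assumes "p - u = a *\<^sub>R (y - u) + b *\<^sub>R (z - u)"
  shows "H p = a * H y + b * H z"
  unfolding H_def assms by (simp add: algebra_simps)

lemma X_comb: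
  assumes "p - u = a *\<^sub>R (y - u) + b *\<^sub>R (z - u)"
  shows "X p = a * X y + b * X z"
  unfolding X_def assms by (simp add: algebra_simps)

lemma Re_frame: "Re ((b - a) * cnj e) = H b - H a"
  by (simp add: H_def algebra_simps)

lemma Im_frame: "Im ((b - a) * cnj e) = - s * (X b - X a)"
  using s by (auto simp: X_def algebra_simps)

lemma cr_frame: "s * cr (b - a) (d - c) = (X b - X a) * (H d - H c) - (H b - H a) * (X d - X c)"
proof -
  have e1: "(Re e)\<^sup>2 + (Im e)\<^sup>2 = 1" using bisectors_norm[OF eD] by (simp add: cmod_def)
  have "Re (y * cnj e) * Im (z * cnj e) - Im (y * cnj e) * Re (z * cnj e)
     = cr y z * ((Re e)\<^sup>2 + (Im e)\<^sup>2)" for y z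
    by (simp add: cr_def power2_eq_square algebra_simps)
  from this[of "b - a" "d - c"] have c: "cr (b - a) (d - c) =
      (H b - H a) * (- s * (X d - X c)) - (- s * (X b - X a)) * (H d - H c)"
    unfolding e1 Re_frame Im_frame by simp
  have "s * cr (b - a) (d - c) = (s * s) * ((X b - X a) * (H d - H c) - (H b - H a) * (X d - X c))"
    unfolding c by (simp add: algebra_simps)
  then show ?thesis by (simp only: ss mult_1)
qed

lemma sector_frame: "sector t e (b - a) \<longleftrightarrow> 0 < H b - H a \<and> \<bar>X b - X a\<bar> < tan t * (H b - H a)"
  unfolding sector_def Re_frame Im_frame using s by (auto simp: abs_mult)

text \<open>The bisector reached from \<open>e\<close> after \<open>j\<close> cones in the direction
  of positive \<open>X\<close>.\<close>

definition rot :: "nat \<Rightarrow> complex" where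
  "rot j = e * cis (- s * (2 * real j * t))"

lemma rot_bisector: "rot j \<in> bisectors n"
proof -
  from s consider "s = of_int (1::int)" | "s = of_int (-1::int)" by auto
  then obtain m :: int where m: "s = of_int m" by metis
  have "rot j = e * cis (of_int (- m * int j) * cone_angle n)"
    unfolding rot_def by (simp add: m cone_angle_t algebra_simps)
  then show ?thesis using bisectors_rotate[OF _ eD, of "- m * int j"] n2 by simp
qed

lemma Re_rot: "Re ((b - a) * cnj (rot j)) =
    (H b - H a) * cos (2 * real j * t) + (X b - X a) * sin (2 * real j * t)"
proof -
  have "(b - a) * cnj (rot j) = ((b - a) * cnj e) * cis (s * (2 * real j * t))"
    by (simp add: rot_def cis_cnj)
  then have "Re ((b - a) * cnj (rot j)) =
    Re ((b - a) * cnj e) * cos (s * (2 * real j * t)) - Im ((b - a) * cnj e) * sin (s * (2 * real j * t))"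
    by (simp only: times_complex.sel cis.sel)
  then show ?thesis unfolding Re_frame Im_frame using s by (auto simp: algebra_simps)
qed

lemma Im_rot: "Im ((b - a) * cnj (rot j)) =
    s * ((H b - H a) * sin (2 * real j * t) - (X b - X a) * cos (2 * real j * t))"
proof -
  have "(b - a) * cnj (rot j) = ((b - a) * cnj e) * cis (s * (2 * real j * t))"
    by (simp add: rot_def cis_cnj)
  then have "Im ((b - a) * cnj (rot j)) =
    Re ((b - a) * cnj e) * sin (s * (2 * real j * t)) + Im ((b - a) * cnj e) * cos (s * (2 * real j * t))"
    by (simp only: times_complex.sel cis.sel)
  then show ?thesis unfolding Re_frame Im_frame using s by (auto simp: algebra_simps)
qed

lemma edge_in_cone:
  assumes p: "p \<in> P" and q: "q \<in> P" and x: "X q - X p = r * sin \<phi>" and h: "H q - H p = r * cos \<phi>"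
    and r: "0 < r" and \<phi>: "\<phi> = 2 * real j * t + \<psi>" and \<psi>: "- t \<le> \<psi>" "\<psi> < t"
  shows "Re ((q - p) * cnj (rot j)) = r * cos \<psi>" "Im ((q - p) * cnj (rot j)) = - s * (r * sin \<psi>)"
    "sector t (rot j) (q - p)" "- t < \<psi>"
proof -
  have \<psi>_eq: "\<psi> = \<phi> - 2 * real j * t" using \<phi> by simp
  show re: "Re ((q - p) * cnj (rot j)) = r * cos \<psi>"
    unfolding Re_rot x h \<psi>_eq cos_diff by (simp add: algebra_simps)
  show im: "Im ((q - p) * cnj (rot j)) = - s * (r * sin \<psi>)"
    unfolding Im_rot x h \<psi>_eq sin_diff by (simp add: algebra_simps)
  have qp: "p \<noteq> q" using x h r by (metis cancel_comm_monoid_add_class.diff_cancel cos_zero_iff_int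
      mult_eq_0_iff less_irrefl sin_cos_squared_add3 zero_neq_one add_0)
  show lt: "- t < \<psi>"
  proof (rule ccontr)
    assume "\<not> - t < \<psi>"
    then have \<psi>t: "\<psi> = - t" using \<psi> by simp
    have "(q - p) * cnj (rot j * cis (s * t)) = ((q - p) * cnj (rot j)) * cis (- s * t)"
      by (simp add: cis_cnj)
    then have "Im ((q - p) * cnj (rot j * cis (s * t)))
       = Re ((q - p) * cnj (rot j)) * sin (- s * t) + Im ((q - p) * cnj (rot j)) * cos (- s * t)"
      by (simp only: times_complex.sel cis.sel)
    also have "\<dots> = 0" unfolding re im \<psi>t using s by auto
    finally have "Im ((q - p) * cnj (rot j * cis (s * t))) = 0" .
    moreover have "Im ((q - p) * cnj (rot j * cis (s * t))) \<noteq> 0"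
      using general_position_bisectors(2,3)[OF gp _ rot_bisector[of j] p q qp] n2 s
      by (auto simp: t_def)
    ultimately show False by simp
  qed
  have ct: "0 < cos \<psi>" using lt \<psi> t_half by (intro cos_gt_zero_pi) auto
  have "tan \<psi> < tan t" using lt \<psi> t_half by (intro tan_monotone) auto
  moreover have "tan (- t) < tan \<psi>" using lt \<psi> t_half by (intro tan_monotone) auto
  ultimately have "\<bar>tan \<psi>\<bar> < tan t" by simp
  moreover have "\<bar>tan \<psi>\<bar> = \<bar>sin \<psi>\<bar> / cos \<psi>" using ct by (simp add: tan_def abs_divide)
  ultimately have "\<bar>sin \<psi>\<bar> < tan t * cos \<psi>" using ct by (simp add: pos_divide_less_eq)
  then have "r * \<bar>sin \<psi>\<bar> < r * (tan t * cos \<psi>)" using r by simp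
  then show "sector t (rot j) (q - p)"
    unfolding sector_def re im using r ct s by (auto simp: abs_mult algebra_simps)
qed

end

section \<open>A single edge \<open>vq\<close> of the hull chain\<close>

locale chain_step = descent + wedge P S u v w for v +
  fixes q :: complex and M :: real
  assumes cv: "sector t e (v - u)" and left: "0 < X w * H v - H w * X v"
    and qP: "q \<in> P" and M1: "1 \<le> M" and Aq: "0 \<le> A q" and Bq: "0 < B q"
    and qM: "A q + M * B q = 1"
    and low: "\<And>p. p \<in> P \<Longrightarrow> p \<noteq> u \<Longrightarrow> 0 \<le> A p \<Longrightarrow> 0 \<le> B p \<Longrightarrow> 1 \<le> A p + M * B p"
    and svq: "sees S v q" and Hvq: "H v < H q" and Hqw: "H q \<le> H w"
begin

definition x where "x = X q - X v"
definition h where "h = H q - H v"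
definition D where "D = X w * H v - H w * X v"

lemma D_pos: "0 < D" using left by (simp add: D_def)
lemma h_pos: "0 < h" using Hvq by (simp add: h_def)

lemma H_coords: "H p = A p * H v + B p * H w"
  by (rule H_comb[OF decomp])

lemma X_coords: "X p = A p * X v + B p * X w"
  by (rule X_comb[OF decomp])

lemma A_eq: "A q = 1 - M * B q" using qM by simp

lemma x_eq: "x = B q * (X w - M * X v)"
  unfolding x_def X_coords[of q] A_eq by (simp add: algebra_simps)

lemma h_eq: "h = B q * (H w - M * H v)"
  unfolding h_def H_coords[of q] A_eq by (simp add: algebra_simps)

lemma HM: "0 < H w - M * H v"
  using h_pos h_eq Bq by (simp add: zero_less_mult_iff)

lemma v_bounds: "0 < H v" "X v < tan t * H v" "- X v < tan t * H v"
  using cv[unfolded sector_frame] by auto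

lemma w_bounds: "0 < H w" "X w < tan t * H w" "- X w < tan t * H w"
  using cw[unfolded sector_frame] by auto

text \<open>As \<open>q\<close> lies to the right of the ray \<open>uv\<close>, the edge
  \<open>vq\<close> leans less to the left than \<open>uv\<close>, which lies inside the
  cone.\<close>

lemma x_lower: "- (tan t * h) < x"
proof -
  have "H v * (X w - M * X v) = D + X v * (H w - M * H v)" by (simp add: D_def algebra_simps)
  moreover have "- (tan t * H v) * (H w - M * H v) \<le> X v * (H w - M * H v)"
    using HM v_bounds by (intro mult_right_mono) auto
  moreover have "H v * - (tan t * (H w - M * H v)) = - (tan t * H v) * (H w - M * H v)" by simp
  ultimately have "H v * - (tan t * (H w - M * H v)) < H v * (X w - M * X v)"
    using D_pos by linarith
  then have "- (tan t * (H w - M * H v)) < X w - M * X v"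
    using v_bounds by (simp only: mult_less_cancel_left_pos)
  then have "B q * - (tan t * (H w - M * H v)) < B q * (X w - M * X v)"
    using Bq by (simp only: mult_less_cancel_left_pos)
  then show ?thesis unfolding x_eq h_eq by (simp add: algebra_simps)
qed

text \<open>\<open>q\<close> is left of the right boundary ray, \<open>v\<close> is right of the
  left one, and \<open>q\<close> is not above \<open>w\<close>. This feeds
  \<open>rotated_proj_less\<close>.\<close>

lemma x_upper: "x * cos t + h * sin t < 2 * H w * sin t"
proof -
  have "A q * X v \<le> A q * (tan t * H v)" using Aq v_bounds by (intro mult_left_mono) auto
  moreover have "B q * X w < B q * (tan t * H w)" using Bq w_bounds by (intro mult_strict_left_mono) auto
  ultimately have "X q < tan t * H q" unfolding X_coords[of q] H_coords[of q] by (simp add: algebra_simps)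
  then have "x < tan t * (H q + H v)" using v_bounds by (simp add: x_def algebra_simps)
  then have "x * cos t < tan t * (H q + H v) * cos t" using cos_t by (intro mult_strict_right_mono)
  also have "\<dots> = sin t * (H q + H v)" using cos_t by (simp add: tan_def)
  also have "\<dots> = sin t * (2 * H q) - h * sin t" by (simp add: h_def algebra_simps)
  also have "sin t * (2 * H q) \<le> sin t * (2 * H w)" using Hqw sin_t by (intro mult_left_mono) auto
  finally show ?thesis by (simp add: algebra_simps)
qed

text \<open>Positive values mean that \<open>p\<close> is to the right of the directed line from
  \<open>v\<close> to \<open>q\<close>, which is the side of \<open>u\<close>.\<close>

lemma line_side: "h * (X p - X v) - (H p - H v) * x = B q * D * (1 - (A p + M * B p))"
  unfolding x_eq h_eq D_def X_coords[of p] H_coords[of p] by (simp add: algebra_simps)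

lemma B_side: "X p * H v - H p * X v = B p * D"
  unfolding D_def X_coords[of p] H_coords[of p] by (simp add: algebra_simps)

lemma A_side: "X w * H p - H w * X p = A p * D"
  unfolding D_def X_coords[of p] H_coords[of p] by (simp add: algebra_simps)

lemma below_line:
  assumes "0 < h * (X p - X v) - (H p - H v) * x"
  shows "A p + M * B p < 1"
  using zero_less_mult_pos[OF assms[unfolded line_side]] Bq D_pos by simp

text \<open>A vertex in the triangle of \<open>vq\<close> to the right of \<open>vq\<close> is below
  the hull line and right of \<open>uv\<close>. It is either in the wedge, against
  \<open>low\<close>, or to the right of \<open>uw\<close> inside the triangle of \<open>uw\<close>,
  against the assumption.\<close>

lemma upper_side_empty:
  assumes E: "side_empty (- s) e u w"
  shows "side_empty (- s) e v q"
  unfolding side_empty_def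
proof (intro ballI impI notI)
  fix p assume p: "p \<in> P" and c: "sector t e (p - v)"
    and pq: "Re ((p - v) * cnj e) < Re ((q - v) * cnj e)" and cr: "0 < - s * cr (q - v) (p - v)"
  have Hp: "H v < H p" "H p < H q" using c[unfolded sector_frame] pq[unfolded Re_frame] by auto
  have "- s * cr (q - v) (p - v) = - (s * cr (q - v) (p - v))" by simp
  also have "\<dots> = h * (X p - X v) - (H p - H v) * x"
    unfolding cr_frame by (simp add: x_def h_def algebra_simps)
  finally have f: "A p + M * B p < 1" using below_line cr by simp
  have "0 < B p"
  proof (rule ccontr)
    assume "\<not> 0 < B p"
    have "(A p - 1) * H v \<le> (- (M * B p)) * H v"
      using f v_bounds by (intro mult_right_mono) auto
    moreover have "0 < (A p - 1) * H v + B p * H w"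
      using Hp(1) H_coords[of p] by (simp add: algebra_simps)
    ultimately have "0 < B p * (H w - M * H v)" by (simp add: algebra_simps)
    then show False using HM \<open>\<not> 0 < B p\<close> by (simp add: zero_less_mult_iff)
  qed
  show False
  proof (cases "0 \<le> A p")
    case True
    have "p \<noteq> u" using Hp v_bounds by auto
    from low[OF p this True] \<open>0 < B p\<close> f show False by simp
  next
    case False
    have "sector t e (p - u)" using sector_add[OF c cv] by simp
    moreover have "Re ((p - u) * cnj e) < Re ((w - u) * cnj e)"
      unfolding Re_frame using Hp Hqw by simp
    moreover have "0 < - s * cr (w - u) (p - u)"
    proof -
      have "- s * cr (w - u) (p - u) = - (X w * H p - H w * X p)"
        using cr_frame[of w u p u] by simp
      also have "\<dots> = - A p * D" by (simp only: A_side)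
      also have "\<dots> > 0" using False D_pos by (simp add: mult_neg_pos)
      finally show ?thesis .
    qed
    ultimately show False using E p by (auto simp: side_empty_def)
  qed
qed

text \<open>The part of the triangle of \<open>qv\<close>, seen from \<open>q\<close>, on the side
  of \<open>u\<close> belongs to the empty polygon: a vertex there would have positive coordinates
  and \<open>A p + M * B p < 1\<close>.\<close>

lemma lower_side_empty: "side_empty s (- rot k) q v"
  unfolding side_empty_def
proof (intro ballI impI notI)
  fix p assume p: "p \<in> P" and c: "sector t (- rot k) (p - q)"
    and pq: "Re ((p - q) * cnj (- rot k)) < Re ((v - q) * cnj (- rot k))"
    and cr: "0 < s * cr (v - q) (p - q)"
  define y where "y = X q - X p"
  define g where "g = H q - H p"
  have a: "2 * real k * t = pi / 2 - t" using kt by (simp add: algebra_simps)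
  have ca: "cos (2 * real k * t) = sin t" "sin (2 * real k * t) = cos t"
    unfolding a by (simp_all add: cos_diff sin_diff)
  have neg: "(b - a) * cnj (- rot k) = (a - b) * cnj (rot k)" for a b
    by (simp add: algebra_simps)
  have R: "Re ((q - p) * cnj (rot k)) = g * sin t + y * cos t"
    and I: "Im ((q - p) * cnj (rot k)) = s * (g * cos t - y * sin t)"
    and Rv: "Re ((q - v) * cnj (rot k)) = h * sin t + x * cos t"
    unfolding Re_rot Im_rot ca by (simp_all add: g_def y_def h_def x_def)
  have c1: "\<bar>g * cos t - y * sin t\<bar> < tan t * (g * sin t + y * cos t)"
    using c s unfolding sector_def neg R I by (auto simp: abs_mult)
  have tc: "cos t * (tan t * z) = sin t * z" for z using cos_t by (simp add: tan_def)
  have c2: "cos t * \<bar>g * cos t - y * sin t\<bar> < sin t * (g * sin t + y * cos t)"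
    using mult_strict_left_mono[OF c1 cos_t] by (simp only: tc)
  have c3: "cos t * (g * cos t - y * sin t) < sin t * (g * sin t + y * cos t)"
    "cos t * - (g * cos t - y * sin t) < sin t * (g * sin t + y * cos t)"
    using le_less_trans[OF mult_left_mono[OF abs_ge_self less_imp_le[OF cos_t]] c2]
      le_less_trans[OF mult_left_mono[OF abs_ge_minus_self less_imp_le[OF cos_t]] c2] .
  have g: "0 < g"
  proof -
    have "0 < g * (cos t * cos t) + g * (sin t * sin t)" using c3(2) by (simp add: algebra_simps)
    then show ?thesis by (simp only: distrib_left[symmetric] sin_cos_squared_add3 mult_1_right)
  qed
  \<comment> \<open>Directions in C_k are more than \<open>pi / 2 - 2 * t\<close> away from the
    bisector of C_0, and this is at least \<open>t\<close> by \<open>t3\<close>. So the way from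
    \<open>q\<close> down to \<open>p\<close> is flatter than the boundary rays of C_0.\<close>
  have y: "g * tan t < y"
  proof -
    have "0 \<le> cos (2 * t + t)" using t3 t_pos by (intro cos_ge_zero) auto
    then have "sin (2 * t) * sin t \<le> cos (2 * t) * cos t"
      using cos_add[of "2 * t" t] by linarith
    then have "2 * sin t * sin t * cos t \<le> (cos t * cos t - sin t * sin t) * cos t"
      unfolding sin_double cos_double by (simp add: power2_eq_square algebra_simps)
    then have "2 * sin t * sin t \<le> cos t * cos t - sin t * sin t"
      using cos_t by (simp only: mult_le_cancel_right_pos)
    then have "g * (2 * sin t * sin t) \<le> g * (cos t * cos t - sin t * sin t)"
      using g by (intro mult_left_mono) auto
    also have "\<dots> < 2 * sin t * (y * cos t)" using c3(1) by (simp add: algebra_simps)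
    finally have "2 * sin t * (g * sin t) < 2 * sin t * (y * cos t)" by (simp add: algebra_simps)
    then have "g * sin t < y * cos t" using sin_t by simp
    then show ?thesis using cos_t by (simp add: tan_def field_simps)
  qed
  \<comment> \<open>\<open>q\<close> is not to the right of \<open>uw\<close>, and so flat a descent
    to the left leads away from \<open>uw\<close>.\<close>
  have Ap: "0 < A p"
  proof -
    have "g * X w \<le> g * (tan t * H w)" using g w_bounds by (intro mult_left_mono) auto
    also have "\<dots> < y * H w" using mult_strict_right_mono[OF y w_bounds(1)] by (simp add: algebra_simps)
    finally have 1: "0 < y * H w - g * X w" by simp
    have "A p * D = (X w * H q - H w * X q) + (y * H w - g * X w)"
      unfolding A_side[symmetric] by (simp add: y_def g_def algebra_simps)
    also have "\<dots> = A q * D + (y * H w - g * X w)" by (simp only: A_side)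
    also have "\<dots> > 0" using 1 Aq D_pos by (simp add: add_nonneg_pos)
    finally show ?thesis using D_pos by (simp add: zero_less_mult_iff)
  qed
  have "s * cr (v - q) (p - q) = h * (X p - X v) - (H p - H v) * x"
    unfolding cr_frame by (simp add: h_def x_def algebra_simps)
  then have pos: "0 < h * (X p - X v) - (H p - H v) * x" using cr by simp
  note f = below_line[OF pos]
  define xp where "xp = X p - X v"
  define hp where "hp = H p - H v"
  \<comment> \<open>The bisector of C_k is orthogonal to the left boundary ray of C_0, so the side
    of the triangle through \<open>v\<close> is parallel to that ray, and \<open>p\<close> is to its
    right.\<close>
  have hx: "0 < hp * sin t + xp * cos t"
    using pq unfolding neg R Rv by (simp add: hp_def xp_def h_def x_def g_def y_def algebra_simps)
  have BD: "B p * D = xp * H v - hp * X v"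
    unfolding B_side[symmetric] by (simp add: xp_def hp_def algebra_simps)
  have "0 < B p * D"
  \<comment> \<open>At or above the height of \<open>v\<close>, \<open>p\<close> is right of
    \<open>vq\<close>, which runs to the right of \<open>uv\<close>. Below \<open>v\<close>, the
    side just described is already to the right of \<open>uv\<close>.\<close>
  proof (cases "0 \<le> hp")
    case True
    have "x * H v - h * X v = B q * D"
      unfolding B_side[symmetric] by (simp add: x_def h_def algebra_simps)
    then have "0 \<le> hp * (x * H v - h * X v)" using True Bq D_pos by simp
    moreover have "hp * x * H v < h * xp * H v"
      using pos v_bounds by (intro mult_strict_right_mono) (auto simp: xp_def hp_def)
    ultimately have "0 < h * (B p * D)" unfolding BD by (simp add: algebra_simps)
    then show ?thesis using h_pos by (simp add: zero_less_mult_iff)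
  next
    case False
    have "(- hp) * (- X v) < (- hp) * (tan t * H v)"
      using False v_bounds by (intro mult_strict_left_mono) auto
    moreover have "- hp * tan t < xp" using hx cos_t by (simp add: tan_def field_simps)
    then have "- hp * tan t * H v < xp * H v" using v_bounds by (intro mult_strict_right_mono)
    ultimately show ?thesis unfolding BD by (simp add: algebra_simps)
  qed
  then have "0 < B p" using D_pos by (simp add: zero_less_mult_iff)
  moreover have "p \<noteq> u" using Ap coords_simps(1) by (metis less_irrefl)
  ultimately show False using low[OF p] Ap f by simp
qed

text \<open>Edges outside C_0 point to the right, and the angle estimates remove the absolute value
  for them. In C_0 it stays for edges to the left, unless the right side is empty.\<close>

lemma edge_bound:
  shows "0 \<le> x \<Longrightarrow> conn P S n v q (K * h + x)"
    and "x < 0 \<Longrightarrow> conn P S n v q (K * h - x)"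
    and "x < 0 \<Longrightarrow> side_empty (- s) e u w \<Longrightarrow> conn P S n v q (K * h + x)"
proof -
  obtain j \<phi> \<psi> r where jr: "0 < r" "h = r * cos \<phi>" "x = r * sin \<phi>" "j \<le> k"
    "\<phi> = 2 * real j * t + \<psi>" "- t \<le> \<psi>" "\<psi> < t" "\<phi> < pi / 2"
    using cone_index[OF kt k t_pos h_pos x_lower] by metis
  note ec = edge_in_cone[OF vP qP jr(3)[unfolded x_def] jr(2)[unfolded h_def] jr(1) jr(5,6,7)]
  have Hsm: "h < H w" using Hqw v_bounds by (simp add: h_def)
  have "conn P S n v q (K * h + x)" if "1 \<le> j"
  proof -
    have sm: "Re ((q - v) * cnj (rot j)) < Re ((w - u) * cnj e)"
      using rotated_proj_less[OF kt t_pos that jr(4) x_upper Hsm w_bounds(1)]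
      unfolding Re_rot Re_frame by (simp add: x_def h_def)
    have jt: "2 * t \<le> 2 * real j * t" using that t_pos by simp
    show ?thesis
    \<comment> \<open>Below the bisector of C_k the hypothesis of \<open>rotated_cone_bound\<close>
      fails; there the edge is viewed from \<open>q\<close>, with the sharper claim.\<close>
    proof (cases "j = k \<and> 0 < \<psi>")
      case False
      have "\<phi> + \<bar>\<psi>\<bar> \<le> 2 * real k * t"
      proof (cases "j = k")
        case True
        then show ?thesis using False jr by auto
      next
        case False
        then have "real j + 1 \<le> real k" using jr(4) by linarith
        then have "2 * t * (real j + 1) \<le> 2 * t * real k" using t_pos by (intro mult_left_mono) auto
        then have "2 * real j * t + 2 * t \<le> 2 * real k * t" by (simp add: algebra_simps)
        then show ?thesis using jr ec(4) by linarith
      qed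
      then have b: "K * cos \<psi> + \<bar>sin \<psi>\<bar> \<le> K * cos \<phi> + sin \<phi>"
        unfolding K_def using jt jr ec(4) by (intro rotated_cone_bound[OF kt t_pos]) linarith+
      have "short (rot j) v q" by (rule IH[OF rot_bisector vP qP svq ec(3) sm])
      then have "conn P S n v q (K * (r * cos \<psi>) + \<bar>- s * (r * sin \<psi>)\<bar>)"
        unfolding short_def ec(1,2) by blast
      moreover have "K * (r * cos \<psi>) + \<bar>- s * (r * sin \<psi>)\<bar> = r * (K * cos \<psi> + \<bar>sin \<psi>\<bar>)"
        using s jr(1) by (auto simp: abs_mult algebra_simps)
      moreover have "\<dots> \<le> r * (K * cos \<phi> + sin \<phi>)" using b jr(1) by simp
      moreover have "\<dots> = K * h + x" by (simp add: jr(2,3) algebra_simps)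
      ultimately show ?thesis using conn_mono by metis
    next
      case True
      have b: "K * cos \<psi> - sin \<psi> = K * cos \<phi> + sin \<phi>"
        unfolding K_def by (rule last_cone_bound[OF kt]) (use cos_t jr True in auto)
      have neg: "(v - q) * cnj (- rot k) = (q - v) * cnj (rot k)"
        by (simp add: algebra_simps)
      have "- rot k \<in> bisectors n"
        by (rule bisectors_minus[OF _ _ rot_bisector]) (use n in auto)
      moreover have "sector t (- rot k) (v - q)"
        using ec(3) True unfolding sector_def neg by simp
      moreover have "Re ((v - q) * cnj (- rot k)) < Re ((w - u) * cnj e)"
        using sm True unfolding neg by simp
      ultimately have "short (- rot k) q v" using IH[OF _ qP vP sees_sym[OF svq]] by blast
      then have "conn P S n q v (K * Re ((v - q) * cnj (- rot k)) + s * Im ((v - q) * cnj (- rot k)))"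
        unfolding short_def using lower_side_empty s by auto
      then have "conn P S n q v (K * (r * cos \<psi>) + s * (- s * (r * sin \<psi>)))"
        unfolding neg using ec(1,2) True by simp
      moreover have "K * (r * cos \<psi>) + s * (- s * (r * sin \<psi>)) = r * (K * cos \<psi> - sin \<psi>)"
        using s by (auto simp: algebra_simps)
      moreover have "\<dots> = K * h + x" unfolding b by (simp add: jr(2,3) algebra_simps)
      ultimately show ?thesis using conn_sym by metis
    qed
  qed
  moreover have "0 \<le> x" if "1 \<le> j"
  proof -
    have "2 * t \<le> 2 * real j * t" using that t_pos by simp
    then have "0 \<le> \<phi>" "\<phi> \<le> pi" using jr t_pos by linarith+
    then show ?thesis using jr(1,3) by (simp add: sin_ge_zero)
  qed
  moreover have "conn P S n v q (K * h + \<bar>x\<bar>) \<and> (side_empty (- s) e u w \<longrightarrow> conn P S n v q (K * h + x))"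
    if "j = 0"
  proof -
    have re: "rot j = e" by (simp add: rot_def that)
    have "short e v q"
    proof (rule IH[OF eD vP qP svq])
      show "sector t e (q - v)" using ec(3) re by simp
      show "Re ((q - v) * cnj e) < Re ((w - u) * cnj e)" unfolding Re_frame using Hsm by (simp add: h_def)
    qed
    have hx: "Re ((q - v) * cnj e) = h" "Im ((q - v) * cnj e) = - s * x"
      unfolding Re_frame Im_frame h_def x_def by simp_all
    from \<open>short e v q\<close> have *: "conn P S n v q (K * h + \<bar>- s * x\<bar>)"
      "\<And>\<sigma>. \<sigma> \<in> {1, -1} \<Longrightarrow> side_empty \<sigma> e v q \<Longrightarrow> conn P S n v q (K * h + \<sigma> * (- s * x))"
      unfolding short_def hx by blast+
    have "\<bar>- s * x\<bar> = \<bar>x\<bar>" "(- s) * (- s * x) = x" "- s \<in> {1, -1}" using s by auto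
    then show ?thesis using *(1) *(2)[of "- s"] upper_side_empty by auto
  qed
  moreover have "j = 0 \<or> 1 \<le> j" by auto
  ultimately show "0 \<le> x \<Longrightarrow> conn P S n v q (K * h + x)"
    and "x < 0 \<Longrightarrow> conn P S n v q (K * h - x)"
    and "x < 0 \<Longrightarrow> side_empty (- s) e u w \<Longrightarrow> conn P S n v q (K * h + x)"
    by fastforce+
qed

end

text \<open>The triangle inequality through the left corner: \<open>h * c\<close> is the length of
  the side up to the corner and \<open>y\<close> the distance from the corner to the end of the
  chord.\<close>

lemma chord_bound:
  fixes t h x :: real
  assumes "0 < cos t" "0 \<le> h" "0 \<le> sin t" "\<bar>x\<bar> \<le> tan t * h"
  shows "sqrt (h\<^sup>2 + x\<^sup>2) \<le> (1 + sin t) / cos t * h + x"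
proof -
  define c where "c = 1 / cos t"
  define y where "y = x + h * tan t"
  have y: "0 \<le> y" using assms(4) by (auto simp: y_def algebra_simps)
  have t0: "0 \<le> tan t" "0 \<le> c" using assms by (simp_all add: tan_def c_def)
  have "(tan t)\<^sup>2 + 1 = c\<^sup>2"
    using tan_sec[of t] assms(1) by (simp add: c_def inverse_eq_divide power_divide)
  then have "h\<^sup>2 * c\<^sup>2 = h\<^sup>2 + (h * tan t)\<^sup>2" by (simp add: power_mult_distrib algebra_simps flip: \<open>(tan t)\<^sup>2 + 1 = c\<^sup>2\<close>)
  then have "(h * c + y)\<^sup>2 - (h\<^sup>2 + (y - h * tan t)\<^sup>2) = 2 * (h * c * y) + 2 * (h * tan t * y)"
    by (simp add: power2_eq_square algebra_simps)
  moreover have "y - h * tan t = x" by (simp add: y_def)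
  ultimately have "(h * c + y)\<^sup>2 - (h\<^sup>2 + x\<^sup>2) = 2 * (h * c * y) + 2 * (h * tan t * y)"
    by simp
  moreover have "0 \<le> h * c * y" "0 \<le> h * tan t * y" using assms y t0 by auto
  ultimately have "h\<^sup>2 + x\<^sup>2 \<le> (h * c + y)\<^sup>2" by linarith
  moreover have "0 \<le> h * c + y" using assms y t0 by auto
  ultimately have "sqrt (h\<^sup>2 + x\<^sup>2) \<le> h * c + y" by (rule real_le_lsqrt[rotated])
  also have "h * c + y = (1 + sin t) / cos t * h + x"
    by (simp add: c_def y_def tan_def add_divide_distrib algebra_simps)
  finally show ?thesis .
qed

context theta_graph begin

lemma sector_length:
  assumes "e \<in> bisectors n" "sector t e z" "\<sigma> = 1 \<or> \<sigma> = -1"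
  shows "cmod z \<le> K * Re (z * cnj e) + \<sigma> * Im (z * cnj e)"
proof -
  have "cmod z = cmod (z * cnj e)" using bisectors_norm[OF assms(1)] by (simp add: norm_mult)
  also have "\<dots> = sqrt ((Re (z * cnj e))\<^sup>2 + (\<sigma> * Im (z * cnj e))\<^sup>2)"
  proof -
    have "\<sigma>\<^sup>2 = 1" using assms(3) by auto
    then show ?thesis by (simp only: cmod_def power_mult_distrib mult_1)
  qed
  also have "\<dots> \<le> K * Re (z * cnj e) + \<sigma> * Im (z * cnj e)"
    unfolding K_def
    by (rule chord_bound) (use cos_t sin_t assms(2,3) in \<open>auto simp: sector_def abs_mult\<close>)
  finally show ?thesis .
qed

end

section \<open>Adding up the bounds along the chain\<close>

context descent begin

text \<open>\<open>R\<close> bounds the horizontal positions in the wedge up to the height of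
  \<open>w\<close>; the horizontal cost is that of going right to \<open>R\<close> and back,
  \<open>(R - X v) + (R - X w)\<close>. The induction passes to the next hull vertex
  \<open>q\<close> and the smaller wedge \<open>uqw\<close>, with fewer vertices above its first
  corner.\<close>

lemma chain_bound:
  assumes "wedge P S u v w" "sector t e (v - u)" "0 < X w * H v - H w * X v"
    and "\<And>p a b. p \<in> P \<Longrightarrow> p \<noteq> u \<Longrightarrow> 0 \<le> a \<Longrightarrow> 0 \<le> b \<Longrightarrow>
      p - u = a *\<^sub>R (v - u) + b *\<^sub>R (w - u) \<Longrightarrow> H v \<le> H p"
    and "\<And>p a b. p \<in> P \<Longrightarrow> p \<noteq> u \<Longrightarrow> 0 \<le> a \<Longrightarrow> 0 \<le> b \<Longrightarrow>
      p - u = a *\<^sub>R (v - u) + b *\<^sub>R (w - u) \<Longrightarrow> H p \<le> H w \<Longrightarrow> X p \<le> R"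
  shows "conn P S n v w (K * (H w - H v) + 2 * R - X v - X w) \<and>
    (side_empty (- s) e u w \<longrightarrow> conn P S n v w (K * (H w - H v) + (X w - X v)))"
  using assms
proof (induction "card {p \<in> P. H v < H p}" arbitrary: v R rule: less_induct)
  case less
  interpret W: wedge P S u v w by (rule less.prems(1))
  note inv = less.prems(4) and RX = less.prems(5)
  obtain q M where q: "q \<in> P" "q \<noteq> v" "1 \<le> M" "0 \<le> W.A q" "0 < W.B q" "W.A q + M * W.B q = 1"
    "\<And>p. p \<in> P \<Longrightarrow> p \<noteq> u \<Longrightarrow> 0 \<le> W.A p \<Longrightarrow> 0 \<le> W.B p \<Longrightarrow> 1 \<le> W.A p + M * W.B p"
    "sees S v q" "sees S u q" "q = w \<or> 0 < W.A q"
    by (rule W.gift_wrap) blast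
  have qu: "q \<noteq> u" using q(5) W.coords_simps(2) by (metis less_irrefl)
  have Hc: "H p = W.A p * H v + W.B p * H w" for p
    by (rule H_comb[OF W.decomp])
  have Xc: "X p = W.A p * X v + W.B p * X w" for p
    by (rule X_comb[OF W.decomp])
  have Hv: "0 < H v" "\<bar>X v\<bar> < tan t * H v"
    using less.prems(2)[unfolded sector_frame] by auto
  have Hw: "0 < H w" "\<bar>X w\<bar> < tan t * H w" using cw[unfolded sector_frame] by auto
  have "H v \<le> H q" by (rule inv[OF q(1) qu q(4) less_imp_le[OF q(5)] W.decomp])
  moreover have "H q - H v \<noteq> 0"
    using general_position_bisectors(1)[OF gp _ eD W.vP q(1)] q(2) n2 unfolding Re_frame by auto
  ultimately have Hvq: "H v < H q" by simp
  have Aq: "W.A q = 1 - M * W.B q" using q(6) by simp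
  have hq: "H q - H v = W.B q * (H w - M * H v)" unfolding Hc[of q] Aq by (simp add: algebra_simps)
  have xq: "X q - X v = W.B q * (X w - M * X v)" unfolding Xc[of q] Aq by (simp add: algebra_simps)
  have "0 < W.B q * (H w - M * H v)" using Hvq hq by linarith
  then have HM: "0 < H w - M * H v" using q(5) by (rule zero_less_mult_pos)
  \<comment> \<open>The hull line meets the ray \<open>uw\<close> at height \<open>H w / M\<close>,
    so it does not descend between \<open>q\<close> and that ray.\<close>
  have "H w - M * H q = (H w - M * H v) - M * (H q - H v)" by (simp add: algebra_simps)
  also have "\<dots> = (H w - M * H v) * W.A q" unfolding hq Aq by (simp add: algebra_simps)
  also have "\<dots> \<ge> 0" using HM q(4) by simp
  finally have HMq: "M * H q \<le> H w" by simp
  moreover have "1 * H q \<le> M * H q" using q(3) Hvq Hv by (intro mult_right_mono) auto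
  ultimately have Hqw: "H q \<le> H w" by simp
  interpret C: chain_step k n P S t K e u w s v q M
    by unfold_locales (use less.prems(2,3) q Hvq Hqw in auto)
  have hx: "C.h = H q - H v" "C.x = X q - X v" by (simp_all add: C.h_def C.x_def)
  have Rv: "X v \<le> R" by (rule RX[of v 1 0]) (use W.vP W.uv Hvq Hqw in auto)
  have Rw: "X w \<le> R" by (rule RX[of w 0 1]) (use W.wP W.uw in auto)
  show ?case
  proof (cases "q = w")
    case True
    show ?thesis
    proof (cases "0 \<le> C.x")
      case x: True
      from C.edge_bound(1)[OF x] have "conn P S n v w (K * (H w - H v) + (X w - X v))"
        unfolding hx unfolding True .
      then show ?thesis using Rw by (auto elim!: conn_mono)
    next
      case False
      then have x: "C.x < 0" by simp
      from C.edge_bound(2)[OF x] have "conn P S n v w (K * (H w - H v) - (X w - X v))"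
        unfolding hx unfolding True .
      moreover have "side_empty (- s) e u w \<longrightarrow> conn P S n v w (K * (H w - H v) + (X w - X v))"
        using C.edge_bound(3)[OF x] unfolding hx unfolding True by blast
      ultimately show ?thesis using Rv by (auto elim!: conn_mono)
    qed
  next
    case False
    then have Aq0: "0 < W.A q" using q(10) by simp
    have sub: "W.A p = a * W.A q" "W.B p = a * W.B q + b"
      if "p - u = a *\<^sub>R (q - u) + b *\<^sub>R (w - u)" for p a b
    proof -
      have "p - u = (a * W.A q) *\<^sub>R (v - u) + (a * W.B q + b) *\<^sub>R (w - u)"
        unfolding that by (subst W.decomp[of q]) (simp add: algebra_simps)
      then show "W.A p = a * W.A q" "W.B p = a * W.B q + b" by (rule W.coords_unique)+
    qed
    have 1: "wedge P S u q w"
    proof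
      fix p a b
      assume p: "p \<in> P" "is_constraint S u p" "p - u = a *\<^sub>R (q - u) + b *\<^sub>R (w - u)" "0 < a" "0 < b"
      show False
        by (rule W.nocon[OF p(1,2) W.decomp])
           (use sub[OF p(3)] p(4,5) Aq0 q(5) in \<open>auto intro: add_pos_pos\<close>)
    qed (use W.fin W.nc W.cons W.uP W.wP W.uw q qu False suw in auto)
    have 2: "sector t e (q - u)"
    proof -
      have "\<bar>X q\<bar> \<le> W.A q * \<bar>X v\<bar> + W.B q * \<bar>X w\<bar>"
        unfolding Xc[of q] using abs_triangle_ineq[of "W.A q * X v" "W.B q * X w"] q(4,5)
        by (simp add: abs_mult)
      also have "\<dots> < W.A q * (tan t * H v) + W.B q * (tan t * H w)"
        using Hv Hw q(5) Aq0 by (intro add_strict_mono mult_strict_left_mono) auto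
      also have "\<dots> = tan t * H q" unfolding Hc[of q] by (simp add: algebra_simps)
      finally show ?thesis unfolding sector_frame using Hv Hvq by simp
    qed
    have 3: "0 < X w * H q - H w * X q"
      unfolding C.A_side using Aq0 C.D_pos by simp
    \<comment> \<open>The hull line through \<open>v\<close> and \<open>q\<close> serves again: as
      \<open>q\<close> is on it, its equation in the new coordinates is
      \<open>a + M * b = 1\<close>.\<close>
    have f: "1 \<le> a + M * b" if "p \<in> P" "p \<noteq> u" "0 \<le> a" "0 \<le> b"
      "p - u = a *\<^sub>R (q - u) + b *\<^sub>R (w - u)" for p a b
    proof -
      have "1 \<le> W.A p + M * W.B p"
        by (rule q(7)[OF that(1,2)]) (use sub[OF that(5)] that(3,4) q(4,5) in auto)
      also have "\<dots> = a * (W.A q + M * W.B q) + M * b" unfolding sub[OF that(5)] by (simp add: algebra_simps)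
      finally show ?thesis using q(6) by simp
    qed
    have 4: "H q \<le> H p" if p: "p \<in> P" "p \<noteq> u" "0 \<le> a" "0 \<le> b"
      "p - u = a *\<^sub>R (q - u) + b *\<^sub>R (w - u)" for p a b
    proof -
      have "0 \<le> (a + M * b - 1) * H q" using f[OF p] Hv Hvq by simp
      moreover have "0 \<le> b * (H w - M * H q)" using HMq p by simp
      moreover have "H p = a * H q + b * H w" by (rule H_comb[OF p(5)])
      ultimately show ?thesis by (simp add: algebra_simps)
    qed
    have "{p \<in> P. H q < H p} \<subset> {p \<in> P. H v < H p}" using Hvq q(1) by auto
    then have sm: "card {p \<in> P. H q < H p} < card {p \<in> P. H v < H p}"
      using fin by (intro psubset_card_mono) auto
    have IHq: "conn P S n q w (K * (H w - H q) + 2 * R' - X q - X w) \<and>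
      (side_empty (- s) e u w \<longrightarrow> conn P S n q w (K * (H w - H q) + (X w - X q)))"
      if R': "\<forall>p \<in> P. \<forall>a b. p \<noteq> u \<and> 0 \<le> a \<and> 0 \<le> b \<and>
        p - u = a *\<^sub>R (q - u) + b *\<^sub>R (w - u) \<and> H p \<le> H w \<longrightarrow> X p \<le> R'" for R'
    proof (rule less.hyps[OF sm 1 2 3])
      fix p a b
      assume p: "p \<in> P" "p \<noteq> u" "0 \<le> a" "0 \<le> b" "p - u = a *\<^sub>R (q - u) + b *\<^sub>R (w - u)"
      show "H q \<le> H p" by (rule 4[OF p])
      show "X p \<le> R'" if "H p \<le> H w" using R' p that by blast
    qed
    show ?thesis
    proof (cases "0 \<le> C.x")
      case True
      have "X p \<le> R" if p: "p \<in> P" "p \<noteq> u" "0 \<le> a" "0 \<le> b"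
        "p - u = a *\<^sub>R (q - u) + b *\<^sub>R (w - u)" "H p \<le> H w" for p a b
        by (rule RX[OF p(1,2) _ _ W.decomp p(6)]) (use sub[OF p(5)] p q(4,5) in auto)
      then have "\<forall>p \<in> P. \<forall>a b. p \<noteq> u \<and> 0 \<le> a \<and> 0 \<le> b \<and>
        p - u = a *\<^sub>R (q - u) + b *\<^sub>R (w - u) \<and> H p \<le> H w \<longrightarrow> X p \<le> R" by blast
      from IHq[OF this] have c: "conn P S n q w (K * (H w - H q) + 2 * R - X q - X w)"
        "side_empty (- s) e u w \<longrightarrow> conn P S n q w (K * (H w - H q) + (X w - X q))" by blast+
      have c0: "conn P S n v q (K * (H q - H v) + (X q - X v))"
        using C.edge_bound(1)[OF True] unfolding hx .
      have "conn P S n v w (K * (H w - H v) + 2 * R - X v - X w)"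
        by (rule conn_mono[OF conn_trans[OF c0 c(1)]]) (simp add: algebra_simps)
      moreover have "conn P S n v w (K * (H w - H v) + (X w - X v))" if "side_empty (- s) e u w"
        by (rule conn_mono[OF conn_trans[OF c0 c(2)[rule_format, OF that]]]) (simp add: algebra_simps)
      ultimately show ?thesis by blast
    next
      case False
      then have x0: "C.x < 0" by simp
      \<comment> \<open>Once an edge points left, convexity keeps all vertices of the smaller wedge
        to the left of \<open>q\<close>, so \<open>R\<close> may be replaced by \<open>X q\<close>
        for the rest of the chain.\<close>
      then have XM: "X w - M * X v < 0" using xq q(5) unfolding hx by (simp add: mult_less_0_iff)
      have Xv0: "X v \<le> 0"
      proof (rule ccontr)
        assume "\<not> X v \<le> 0"
        then have "0 \<le> X v * (H w - M * H v)" using HM by simp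
        moreover have "H v * (X w - M * X v) < 0" using Hv XM by (simp add: mult_pos_neg)
        ultimately show False using less.prems(3) by (simp add: algebra_simps)
      qed
      have Xq0: "X q \<le> 0" using Xv0 x0 by (simp add: hx)
      have "X w - M * X q = (X w - M * X v) - M * (X q - X v)" by (simp add: algebra_simps)
      also have "\<dots> = (X w - M * X v) * W.A q" unfolding xq Aq by (simp add: algebra_simps)
      also have "\<dots> \<le> 0" using XM Aq0 by (simp add: mult_nonpos_nonneg)
      finally have XMq: "X w - M * X q \<le> 0" .
      have "X p \<le> X q" if p: "p \<in> P" "p \<noteq> u" "0 \<le> a" "0 \<le> b"
        "p - u = a *\<^sub>R (q - u) + b *\<^sub>R (w - u)" "H p \<le> H w" for p a b
      proof -
        have "(a + M * b - 1) * X q \<le> 0" using f[OF p(1-5)] Xq0 by (simp add: mult_nonneg_nonpos)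
        moreover have "b * (X w - M * X q) \<le> 0" using XMq p by (simp add: mult_nonneg_nonpos)
        moreover have "X p = a * X q + b * X w" by (rule X_comb[OF p(5)])
        ultimately show ?thesis by (simp add: algebra_simps)
      qed
      then have "\<forall>p \<in> P. \<forall>a b. p \<noteq> u \<and> 0 \<le> a \<and> 0 \<le> b \<and>
        p - u = a *\<^sub>R (q - u) + b *\<^sub>R (w - u) \<and> H p \<le> H w \<longrightarrow> X p \<le> X q" by blast
      from IHq[OF this] have c: "conn P S n q w (K * (H w - H q) + 2 * X q - X q - X w)"
        "side_empty (- s) e u w \<longrightarrow> conn P S n q w (K * (H w - H q) + (X w - X q))" by blast+
      have c0: "conn P S n v q (K * (H q - H v) - (X q - X v))"
        using C.edge_bound(2)[OF x0] unfolding hx .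
      have "conn P S n v w (K * (H w - H v) + 2 * R - X v - X w)"
        by (rule conn_mono[OF conn_trans[OF c0 c(1)]]) (use Rv in \<open>simp add: algebra_simps\<close>)
      moreover have "conn P S n v w (K * (H w - H v) + (X w - X v))" if E: "side_empty (- s) e u w"
      proof -
        have c0: "conn P S n v q (K * (H q - H v) + (X q - X v))"
          using C.edge_bound(3)[OF x0 E] unfolding hx .
        show ?thesis
          by (rule conn_mono[OF conn_trans[OF c0 c(2)[rule_format, OF E]]]) (simp add: algebra_simps)
      qed
      ultimately show ?thesis by blast
    qed
  qed
qed

end

section \<open>The strong induction over pairs of vertices\<close>

context theta_graph begin

text \<open>Heights are real numbers, so the induction runs on the finite number of triples of a
  bisector and two vertices that have a smaller height.\<close>

lemma short_pairs:
  assumes "e \<in> bisectors n" "u \<in> P" "w \<in> P" "sees S u w" "sector t e (w - u)"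
  shows "short e u w"
  using assms
proof (induction "card {(e', a, b). e' \<in> bisectors n \<and> a \<in> P \<and> b \<in> P \<and>
      Re ((b - a) * cnj e') < Re ((w - u) * cnj e)}" arbitrary: e u w rule: less_induct)
  case less
  note eD = less.prems(1) and uP = less.prems(2) and wP = less.prems(3)
    and suw = less.prems(4) and cw = less.prems(5)
  have uw: "u \<noteq> w" using cw by (auto simp: sector_def)
  have IH: "short e' a b" if "e' \<in> bisectors n" "a \<in> P" "b \<in> P" "sees S a b" "sector t e' (b - a)"
    "Re ((b - a) * cnj e') < Re ((w - u) * cnj e)" for e' a b
  proof (rule less.hyps[OF _ that(1-5)])
    let ?T = "\<lambda>r. {(e', a, b). e' \<in> bisectors n \<and> a \<in> P \<and> b \<in> P \<and> Re ((b - a) * cnj e') < r}"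
    have "?T (Re ((w - u) * cnj e)) \<subseteq> bisectors n \<times> P \<times> P" by auto
    moreover have "finite (bisectors n \<times> P \<times> P)" using fin by (simp add: bisectors_def)
    ultimately have "finite (?T (Re ((w - u) * cnj e)))" by (rule finite_subset)
    moreover have "(e', a, b) \<in> ?T (Re ((w - u) * cnj e))" using that by simp
    moreover have "(e', a, b) \<notin> ?T (Re ((b - a) * cnj e'))" by simp
    moreover have "?T (Re ((b - a) * cnj e')) \<subseteq> ?T (Re ((w - u) * cnj e))" using that(6) by fastforce
    ultimately show "card (?T (Re ((b - a) * cnj e'))) < card (?T (Re ((w - u) * cnj e)))"
      by (intro psubset_card_mono) blast+
  qed
  obtain v where v: "v \<in> P" "theta_edge P S n u v" "sees S u v" "sector t e (v - u)"
    "Re ((v - u) * cnj e) \<le> Re ((w - u) * cnj e)"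
    "\<And>p a b. p \<in> P \<Longrightarrow> p - u = a *\<^sub>R (v - u) + b *\<^sub>R (w - u) \<Longrightarrow> 0 < a \<Longrightarrow> 0 < b \<Longrightarrow>
       cr (v - u) (w - u) \<noteq> 0 \<Longrightarrow>
       \<not> is_constraint S u p \<and> (sees S u p \<longrightarrow> Re ((v - u) * cnj e) \<le> Re ((p - u) * cnj e))"
    using closest_visible[OF n2 fin uP wP suw eD] cw unfolding t_def by metis
  have uv: "u \<noteq> v" using v(4) by (auto simp: sector_def)
  show ?case
  proof (cases "v = w")
    case True
    have c: "conn P S n u w (cmod (w - u))" using conn_edge v(2) True by simp
    have l: "cmod (w - u) \<le> K * Re ((w - u) * cnj e) + \<sigma> * Im ((w - u) * cnj e)"
      if "\<sigma> = 1 \<or> \<sigma> = -1" for \<sigma> using sector_length[OF eD cw that] .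
    have "cmod (w - u) \<le> K * Re ((w - u) * cnj e) + \<bar>Im ((w - u) * cnj e)\<bar>"
      using l[of 1] abs_ge_self[of "Im ((w - u) * cnj e)"] by linarith
    then show ?thesis unfolding short_def using conn_mono[OF c] l by blast
  next
    case False
    have D: "cr (v - u) (w - u) \<noteq> 0" using nc[OF uP v(1) wP] uv uw False by blast
    \<comment> \<open>The sign for which \<open>v\<close> is to the left of \<open>uw\<close> in the
      reflected picture.\<close>
    define s where "s = (if 0 < cr (w - u) (v - u) then 1 else -1 :: real)"
    have s: "s = 1 \<or> s = -1" by (simp add: s_def)
    have "cr (w - u) (v - u) = - cr (v - u) (w - u)" by (simp add: cr_def)
    then have scr: "0 < s * cr (w - u) (v - u)" using D by (auto simp: s_def)
    interpret descent k n P S t K e u w s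
      by unfold_locales (use eD s uP wP suw cw IH in auto)
    interpret W: wedge P S u v w
      by unfold_locales (use fin nc cons uP v(1,3) wP uv uw False suw v(6) D in auto)
    have left: "0 < X w * H v - H w * X v" using scr unfolding cr_frame by simp
    have Hv: "0 < H v" "\<bar>X v\<bar> < tan t * H v" using v(4)[unfolded sector_frame] by auto
    have Hw: "0 < H w" "\<bar>X w\<bar> < tan t * H w" using cw[unfolded sector_frame] by auto
    have Hvw: "H v < H w"
      using v(5) general_position_bisectors(1)[OF gp _ eD v(1) wP False] n2 unfolding Re_frame by simp
    have Hc: "H p = W.A p * H v + W.B p * H w" for p
      by (rule H_comb[OF W.decomp])
    have low: "H v \<le> H p" if p: "p \<in> P" "p \<noteq> u" "0 \<le> W.A p" "0 \<le> W.B p" for p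
    proof (rule ccontr)
      assume "\<not> H v \<le> H p"
      \<comment> \<open>A lowest vertex of the wedge, if lower than \<open>v\<close>, would be
        visible from \<open>u\<close>, against the choice of \<open>v\<close>. The supporting line
        is the horizontal one through it, whence the coefficients \<open>H v / H q\<close> and
        \<open>H w / H q\<close> below.\<close>
      define Q where "Q = {p \<in> P. p \<noteq> u \<and> 0 \<le> W.A p \<and> 0 \<le> W.B p \<and> H p < H v}"
      have "finite Q" "p \<in> Q" using fin p \<open>\<not> H v \<le> H p\<close> by (auto simp: Q_def)
      then obtain q where q: "q \<in> Q" "\<And>p. p \<in> Q \<Longrightarrow> H q \<le> H p"
        using arg_min_if_finite[of Q H] arg_min_least[of Q _ H] by (metis empty_iff)
      have qq: "q \<in> P" "q \<noteq> u" "0 \<le> W.A q" "0 \<le> W.B q" "H q < H v" using q(1) by (auto simp: Q_def)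
      have AB: "0 < W.A q" "0 < W.B q"
        using W.A_zero[OF qq(1) _ qq(2)] W.B_zero[OF qq(1) _ qq(2)] qq(3-5) Hvw by force+
      have Hq: "0 < H q" unfolding Hc[of q] using AB Hv Hw by (simp add: add_pos_pos)
      have f: "H v / H q * W.A z + H w / H q * W.B z = H z / H q" for z
        unfolding Hc[of z] by (simp add: add_divide_distrib mult.commute)
      have "sees S u q"
      proof (rule W.lowest_visible)
        show "1 \<le> H v / H q" "1 \<le> H w / H q" using Hq qq(5) Hvw by simp_all
        fix z assume z: "z \<in> P" "z \<noteq> u" "0 \<le> W.A z" "0 \<le> W.B z"
        have "H q \<le> H z"
          using q(2)[of z] z qq(5) by (cases "H z < H v") (auto simp: Q_def)
        then show "1 \<le> H v / H q * W.A z + H w / H q * W.B z" unfolding f using Hq by simp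
      next
        show "H v / H q * W.A q + H w / H q * W.B q = 1" unfolding f using Hq by simp
      qed (use AB in auto)
      then have "H v \<le> H q" using v(6)[OF qq(1) W.decomp AB D] unfolding Re_frame by simp
      then show False using qq by simp
    qed
    \<comment> \<open>The wedge is left of \<open>uw\<close>, so \<open>max 0 (X w)\<close> serves
      as \<open>R\<close>; then \<open>2 * R - X w\<close> is the absolute value of
      \<open>X w\<close>.\<close>
    have chain: "conn P S n v w (K * (H w - H v) + 2 * max 0 (X w) - X v - X w) \<and>
      (side_empty (- s) e u w \<longrightarrow> conn P S n v w (K * (H w - H v) + (X w - X v)))"
    proof (rule chain_bound[OF W.wedge_axioms v(4) left])
      fix p a b
      assume p: "p \<in> P" "p \<noteq> u" "0 \<le> a" "0 \<le> b" "p - u = a *\<^sub>R (v - u) + b *\<^sub>R (w - u)"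
      show "H v \<le> H p" using low[OF p(1,2)] W.coords_unique[OF p(5)] p(3,4) by simp
      assume Hp: "H p \<le> H w"
      have Hp0: "0 < H p" using \<open>H v \<le> H p\<close> Hv by simp
      have "H p = a * H v + b * H w" "X p = a * X v + b * X w"
        using H_comb[OF p(5)] X_comb[OF p(5)] .
      then have "X w * H p - H w * X p = a * (X w * H v - H w * X v)" by (simp add: algebra_simps)
      moreover have "0 \<le> a * (X w * H v - H w * X v)" using p left by simp
      ultimately have XH: "H w * X p \<le> X w * H p" by simp
      show "X p \<le> max 0 (X w)"
      proof (cases "X w \<le> 0")
        case True
        then have "H w * X p \<le> 0" using XH Hp0 mult_nonpos_nonneg[of "X w" "H p"] by simp
        then have "X p \<le> 0" using Hw by (simp add: mult_le_0_iff)
        then show ?thesis by simp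
      next
        case False
        then have "X w * H p \<le> X w * H w" using Hp by (intro mult_left_mono) auto
        then have "H w * X p \<le> H w * X w" using XH by (simp add: mult.commute)
        then show ?thesis using Hw by simp
      qed
    qed
    have fr: "Re ((w - u) * cnj e) = H w" "Im ((w - u) * cnj e) = - s * X w"
      unfolding Re_frame Im_frame by simp_all
    have "Re ((v - u) * cnj e) = H v" "- s * Im ((v - u) * cnj e) = X v"
      unfolding Re_frame Im_frame using s by auto
    then have lv: "cmod (v - u) \<le> K * H v + X v"
      using sector_length[OF eD v(4), of "- s"] s by auto
    have c1: "conn P S n u w (K * H w + \<bar>- s * X w\<bar>)"
    proof (rule conn_mono[OF conn_Cons[OF v(2) chain[THEN conjunct1]]])
      have "\<bar>- s * X w\<bar> = 2 * max 0 (X w) - X w" using s by (auto simp: abs_if max_def)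
      then show "cmod (v - u) + (K * (H w - H v) + 2 * max 0 (X w) - X v - X w) \<le> K * H w + \<bar>- s * X w\<bar>"
        using lv by (simp add: algebra_simps)
    qed
    have c2: "conn P S n u w (K * H w + X w)" if "side_empty (- s) e u w"
      by (rule conn_mono[OF conn_Cons[OF v(2) chain[THEN conjunct2, rule_format, OF that]]])
         (use lv in \<open>simp add: algebra_simps\<close>)
    \<comment> \<open>\<open>v\<close> itself lies in the part of the triangle on the side
      \<open>s\<close>, so the sharper claim only concerns \<open>- s\<close>.\<close>
    have c3: "\<not> side_empty s e u w"
      using v(1,4) scr Hvw unfolding side_empty_def Re_frame by auto
    have "conn P S n u w (K * H w + \<sigma> * (- s * X w))" if "\<sigma> \<in> {1, -1}" "side_empty \<sigma> e u w" for \<sigma>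
    proof -
      have "\<sigma> \<noteq> s" using c3 that by auto
      then have "\<sigma> = - s" using that s by auto
      then have eq: "\<sigma> * (- s * X w) = X w" using s by auto
      show ?thesis unfolding eq using c2 that(2) \<open>\<sigma> = - s\<close> by blast
    qed
    then show ?thesis unfolding short_def fr using c1 by blast
  qed
qed

end

section \<open>From cone coordinates to the angle \<alpha>\<close>

theorem theorem1:
  fixes k :: nat and P :: "complex set" and S :: "(complex \<times> complex) set"
    and u w :: complex and i :: nat
  defines "n \<equiv> 4 * k + 2"
  defines "\<theta> \<equiv> cone_angle n"
  assumes "k \<ge> 1"
    and "finite P"
    and "general_position n P"
    and "constraints_on P S"
    and "u \<in> P" and "w \<in> P" and "u \<noteq> w"
    and "sees S u w"
    and "i < n" and "in_cone n i u w"
  shows "let m = (tri_corner n i u w 1 + tri_corner n i u w (-1)) / 2;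
             \<alpha> = vec_angle (w - u) (m - u)
         in \<exists>ps. is_path P S n ps u w \<and>
              path_length ps \<le> ((1 + sin (\<theta> / 2)) / cos (\<theta> / 2) * cos \<alpha> + sin \<alpha>) * cmod (w - u)"
proof -
  define t where "t = \<theta> / 2"
  define K where "K = (1 + sin t) / cos t"
  interpret theta_graph k n P S t K
    by unfold_locales (use assms in \<open>auto simp: t_def K_def\<close>)
  define e where "e = bis n i"
  define z where "z = (w - u) * cnj e"
  have eD: "e \<in> bisectors n" using assms(11) by (auto simp: e_def bisectors_def)
  have sec: "sector t e (w - u)"
    using assms(12) in_cone_iff(1)[OF n2] by (simp add: t_def \<theta>_def e_def)
  have "short e u w" by (rule short_pairs[OF eD assms(7,8,10) sec])
  then have conn: "conn P S n u w (K * Re z + \<bar>Im z\<bar>)" by (simp add: short_def z_def)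
  have pos: "0 < Re z" using sec by (simp add: sector_def z_def)
  have ne: "cmod e = 1" by (rule bisectors_norm[OF eD])
  then have nz: "cmod z = cmod (w - u)" by (simp add: z_def norm_mult)
  have nz0: "0 < cmod z" using pos by auto
  define m where "m = (tri_corner n i u w 1 + tri_corner n i u w (-1)) / 2"
  define c where "c = complex_of_real (Re z / cos t) * e"
  \<comment> \<open>The corners are symmetric about the bisector, so their midpoint is the
    projection of \<open>w\<close> onto it, and \<alpha> is the angle between \<open>uw\<close> and
    the bisector.\<close>
  have "tri_corner n i u w 1 = u + c * cis t" "tri_corner n i u w (-1) = u + c * cis (- t)"
    unfolding tri_corner_def proj_def c_def z_def e_def t_def \<theta>_def by simp_all
  then have "m - u = c * ((cis t + cis (- t)) / 2)" by (simp add: m_def field_simps)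
  also have "(cis t + cis (- t)) / 2 = complex_of_real (cos t)" by (simp add: complex_eq_iff)
  finally have m: "m - u = complex_of_real (Re z) * e" using cos_t by (simp add: c_def)
  define \<alpha> where "\<alpha> = vec_angle (w - u) (m - u)"
  have "inner (w - u) (m - u) = Re z * Re z"
    unfolding m inner_complex_def z_def by (simp add: algebra_simps)
  moreover have "norm (m - u) = Re z" unfolding m using pos ne by (simp add: norm_mult)
  ultimately have \<alpha>: "\<alpha> = arccos (Re z / cmod z)"
    unfolding \<alpha>_def vec_angle_def using pos nz by simp
  have b: "\<bar>Re z / cmod z\<bar> \<le> 1" using nz0 abs_Re_le_cmod[of z] by (simp add: abs_divide)
  have cosa: "cos \<alpha> * cmod z = Re z" using b nz0 by (simp add: \<alpha> cos_arccos_abs)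
  \<comment> \<open>The angle is unsigned, so its sine recovers the absolute value of the offset
    \<open>Im z\<close>.\<close>
  have "(sin \<alpha> * cmod z)\<^sup>2 = (cmod z)\<^sup>2 - (cos \<alpha> * cmod z)\<^sup>2"
    by (simp add: power_mult_distrib sin_squared_eq algebra_simps)
  also have "\<dots> = (Im z)\<^sup>2" unfolding cosa by (simp add: cmod_power2)
  finally have "\<bar>sin \<alpha> * cmod z\<bar> = \<bar>Im z\<bar>" unfolding power2_eq_iff by auto
  moreover have "0 \<le> sin \<alpha>"
    unfolding \<alpha> using b[unfolded abs_le_iff]
    by (intro sin_ge_zero arccos_lbound arccos_ubound) linarith+
  ultimately have sina: "sin \<alpha> * cmod z = \<bar>Im z\<bar>" using nz0 by (simp add: abs_mult)
  have "(K * cos \<alpha> + sin \<alpha>) * cmod (w - u) = K * (cos \<alpha> * cmod z) + sin \<alpha> * cmod z"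
    by (simp add: nz algebra_simps)
  then have eq: "(K * cos \<alpha> + sin \<alpha>) * cmod (w - u) = K * Re z + \<bar>Im z\<bar>"
    by (simp only: cosa sina)
  have K: "(1 + sin (\<theta> / 2)) / cos (\<theta> / 2) = K" by (simp add: K_def t_def \<theta>_def)
  show ?thesis
    unfolding Let_def m_def[symmetric] \<alpha>_def[symmetric] K eq
    using conn unfolding conn_def .
qed

end
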